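(* Consider the Cramér-Lundberg model with claim arrival rate $\lambda>0$, premium rate $r>0$ and generic non-negative claim size $B$, where $\lambda\,\mathbb{E}B<r$, inspected at rate $\omega>0$, and let $\tilde p(u)$ be the bankruptcy probability with initial capital $u$ (as defined in the context). Assume $B\in\mathscr{S}^\star$. Then, as $u\to\infty$, $$\tilde p(u)\sim\frac{\lambda\,\mathbb{E}B}{r-\lambda\,\mathbb{E}B}\,\mathbb{P}(B^{\rm res}>u),$$ where $f(u)\sim g(u)$ means $f(u)/g(u)\to 1$ as $u\to\infty$.
   Context: Let $Y(t)=\sum_{i=1}^{N(t)}B_i-rt$, where $N$ is a Poisson process of rate $\lambda$ and $B_1,B_2,\dots$ are i.i.d. copies of $B$, independent of $N$; $u-Y(t)$ is the surplus at time $t$ for initial capital $u$. The process is inspected at the epochs $0=I_0<I_1<I_2<\dots$ of a Poisson process of intensity $\omega$, independent of $Y$. Bankruptcy occurs if the surplus is negative at some inspection epoch: $\tilde p(u)=\mathbb{P}\left(\sup_{n\geqslant 0}Y(I_n)>u\right)$. A real random variable $U$ belongs to the class $\mathscr{S}^\star$ iff $\overline F_U(x):=\mathbb{P}(U>x)$ is positive for all $x$ and $$\int_0^x\overline F_U(x-y)\,\overline F_U(y)\,\mathrm{d}y\sim 2m_U\,\overline F_U(x)\quad\text{as }x\to\infty,$$ where $m_U=\int_0^\infty\overline F_U(y)\,\mathrm{d}y$ denotes the (finite) mean of $U$ restricted to the positive half-axis. The random variable $B^{\rm res}$ has distribution function $\mathbb{P}(B^{\rm res}\leqslant x)=\int_0^x\frac{\mathbb{P}(B>y)}{\mathbb{E}B}\,\mathrm{d}y$,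 $x\geqslant 0$. *)

theory Defs
  imports "HOL-Probability.Probability" "HOL-Library.Landau_Symbols"
begin

text \<open>
  Independence of two random elements with different value types, which \<open>prob_space.indep_var\<close>
  does not cover.  As there, the independent set systems are the generated \<open>\<sigma>\<close>-algebras.
\<close>

definition indep_elems ::
    "'a measure \<Rightarrow> 'b measure \<Rightarrow> ('a \<Rightarrow> 'b) \<Rightarrow> 'c measure \<Rightarrow> ('a \<Rightarrow> 'c) \<Rightarrow> bool" where
  "indep_elems M S X T Z \<longleftrightarrow>
     X \<in> M \<rightarrow>\<^sub>M S \<and> Z \<in> M \<rightarrow>\<^sub>M T \<and>
     prob_space.indep_set M
       {X -` A \<inter> space M | A. A \<in> sets S}
       {Z -` A \<inter> space M | A. A \<in> sets T}"

text \<open>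
  The epochs of a homogeneous Poisson process on the positive half-line, given by i.i.d.
  exponential interarrival times.  Epoch \<open>0\<close> is the time origin and not an arrival.
\<close>

definition poisson_epochs :: "'a measure \<Rightarrow> real \<Rightarrow> (nat \<Rightarrow> 'a \<Rightarrow> real) \<Rightarrow> bool" where
  "poisson_epochs M rate T \<longleftrightarrow>
     (\<forall>w\<in>space M. T 0 w = 0 \<and> strict_mono (\<lambda>n. T n w)) \<and>
     prob_space.indep_vars M (\<lambda>_. borel) (\<lambda>n w. T (Suc n) w - T n w) UNIV \<and>
     (\<forall>n. distributed M lborel (\<lambda>w. T (Suc n) w - T n w) (exponential_density rate))"

text \<open>
  The sample paths are constrained at times \<open>t \<ge> 0\<close> only.  The set of arrivals up to time \<open>t\<close> is
  almost surely finite; on the exceptional null set \<open>card\<close> returns \<open>0\<close>.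
\<close>

definition poisson_process :: "'a measure \<Rightarrow> real \<Rightarrow> (real \<Rightarrow> 'a \<Rightarrow> nat) \<Rightarrow> bool" where
  "poisson_process M rate N \<longleftrightarrow>
     (\<exists>T. poisson_epochs M rate T \<and>
          (\<forall>t\<ge>0. \<forall>w\<in>space M. N t w = card {n. 1 \<le> n \<and> T n w \<le> t}))"

text \<open>The claim sizes \<open>B\<^sub>1, B\<^sub>2, \<dots>\<close> are \<open>C 0, C 1, \<dots>\<close>.\<close>

definition net_claims ::
    "(real \<Rightarrow> 'a \<Rightarrow> nat) \<Rightarrow> (nat \<Rightarrow> 'a \<Rightarrow> real) \<Rightarrow> real \<Rightarrow> real \<Rightarrow> 'a \<Rightarrow> real" where
  "net_claims N C r t w = (\<Sum>i<N t w. C i w) - r * t"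

text \<open>
  The supremum is taken in the extended reals, since a supremum of an unbounded set of reals
  carries no information.
\<close>

definition bankruptcy_prob ::
    "'a measure \<Rightarrow> (real \<Rightarrow> 'a \<Rightarrow> real) \<Rightarrow> (nat \<Rightarrow> 'a \<Rightarrow> real) \<Rightarrow> real \<Rightarrow> real" where
  "bankruptcy_prob M Y I u = \<P>(w in M. (SUP n. ereal (Y (I n w) w)) > ereal u)"

definition tail :: "'a measure \<Rightarrow> ('a \<Rightarrow> real) \<Rightarrow> real \<Rightarrow> real" where
  "tail M U x = \<P>(w in M. U w > x)"

definition S_star :: "'a measure \<Rightarrow> ('a \<Rightarrow> real) \<Rightarrow> bool" where
  "S_star M U \<longleftrightarrow>
     (\<forall>x. tail M U x > 0) \<and>
     set_integrable lborel {0..} (tail M U) \<and>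
     (\<lambda>x. LBINT y:{0..x}. tail M U (x - y) * tail M U y)
       \<sim>[at_top] (\<lambda>x. 2 * (LBINT y:{0..}. tail M U y) * tail M U x)"

definition residual_lifetime :: "'a measure \<Rightarrow> ('a \<Rightarrow> real) \<Rightarrow> ('a \<Rightarrow> real) \<Rightarrow> bool" where
  "residual_lifetime M B R \<longleftrightarrow>
     R \<in> borel_measurable M \<and>
     (\<forall>x\<ge>0. \<P>(w in M. R w \<le> x) = (LBINT y:{0..x}. tail M B y / (\<integral>w. B w \<partial>M)))"

end

theory Submission
  imports Defs
begin

text \<open>
  Write \<open>\<psi>(u)\<close> for the probability that the random walk with increments \<open>C\<^sub>i - r \<tau>\<^sub>i\<close> (claim minus premium
  earned in the preceding interarrival time) ever exceeds \<open>u\<close>.  An inspection can only find the surplus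
  below zero if this walk has exceeded \<open>u\<close>, so \<open>\<psi>(u)\<close> is an upper bound.  Conversely, once the walk has
  exceeded \<open>u + r L\<close>, the surplus stays below zero for \<open>L\<close> time units, which contain an inspection with
  probability at least \<open>1 - exp (- \<omega> L)\<close>.  Since integrated tails are asymptotically invariant under
  shifts, it suffices to find the asymptotics of \<open>\<psi>\<close>.

  The Pollaczek-Khinchine equation \<open>g(u) = a (Q(u) + \<integral>\<^sub>0\<^sup>u P(B > y) g(u - y) dy)\<close>, with \<open>a = \<lambda> / r\<close> and
  \<open>Q(u) = \<integral>\<^sub>u\<^sup>\<infinity> P(B > y) dy\<close>, has a solution which is asymptotic to \<open>a / (1 - a E B) Q\<close>: a Kesten-type bound
  gives \<open>g = O(Q)\<close>, and then upper and lower limits of \<open>g / Q\<close> are squeezed by the equation.  Fubini's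
  theorem turns it into the one-step equation of the walk, whose solutions vanishing at infinity are
  unique; hence \<open>\<psi> = g\<close>.
\<close>

subsection \<open>The integrated tail\<close>

text \<open>All analysis runs in \<open>ennreal\<close> with claim tails cut off to the half-line:
  convolutions on [0, u] become integrals over the whole line and Fubini needs no integrability, at
  the price that every cancellation requires a finite term. Premium is the unit of time, so the
  premium earned between two claims is exponential with rate a = lambda / r. In the
  Pollaczek-Khinchine equation, \<open>a\<close> times the claim tail is the defective ladder height
  density of the walk, of mass a E B < 1. Solving the equation by monotone iteration stands in for
  the ladder decomposition; the link to the walk is made analytically afterwards. With m = E B, the
  limiting constant is the fixed point of c = a + a m c, and Q(u) = m P(B_res > u) turns it into
  lambda m / (r - lambda m). The bound g = O(Q) has a second use: it makes g vanish at infinity.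
  That \<psi> lies below g follows from finite horizons. In the inspection bound, L is chosen before
  u tends to infinity, so large that 1 - exp(- omega L) is close to 1.\<close>

definition pos_tail :: "real measure \<Rightarrow> real \<Rightarrow> ennreal" where
  "pos_tail \<beta> y = emeasure \<beta> {y<..} * indicator {0..} y"

lemma (in finite_measure) borel_measurable_emeasure_mono:
  fixes A :: "real \<Rightarrow> 'a set"
  assumes "\<And>x. A x \<in> sets M" "\<And>x y. x \<le> y \<Longrightarrow> A x \<subseteq> A y"
  shows "(\<lambda>x. emeasure M (A x)) \<in> borel_measurable borel"
proof -
  have "mono (\<lambda>x. measure M (A x))"
    using assms by (intro monoI finite_measure_mono) auto
  from borel_measurable_mono[OF this] show ?thesis
    unfolding emeasure_eq_measure by measurable
qed

lemma (in finite_measure) borel_measurable_emeasure_antimono: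
  fixes A :: "real \<Rightarrow> 'a set"
  assumes "\<And>x. A x \<in> sets M" "\<And>x y. x \<le> y \<Longrightarrow> A y \<subseteq> A x"
  shows "(\<lambda>x. emeasure M (A x)) \<in> borel_measurable borel"
proof -
  have "(\<lambda>x. emeasure M (A (- x))) \<in> borel_measurable borel"
    using assms by (intro borel_measurable_emeasure_mono) auto
  from measurable_compose[OF borel_measurable_uminus[OF measurable_ident] this] show ?thesis
    by simp
qed

text \<open>\<open>\<beta>\<close> is the claim law and \<open>a\<close> the ratio of arrival rate
  to premium rate. \<open>self_convolution\<close> is the upper half of the defining asymptotics of
  the class, in a form without division; as \<open>pos_tail\<close> vanishes on negative arguments,
  its integrand lives on [0, x].\<close>

locale integrated_tail = prob_space \<beta> for \<beta> :: "real measure" +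
  fixes a m :: real
  assumes sets_beta [measurable_cong, simp]: "sets \<beta> = sets borel"
    and nonneg: "emeasure \<beta> {..<0} = 0"
    and tail_pos: "\<And>x. emeasure \<beta> {x<..} \<noteq> 0"
    and a_pos: "0 < a"
    and mean: "(\<integral>\<^sup>+y. pos_tail \<beta> y \<partial>lborel) = ennreal m"
    and am: "a * m < 1"
    and self_convolution: "\<And>e. 0 < e \<Longrightarrow>
      \<forall>\<^sub>F x in at_top. (\<integral>\<^sup>+y. pos_tail \<beta> (x - y) * pos_tail \<beta> y \<partial>lborel) \<le> ennreal (2 * m + e) * pos_tail \<beta> x"
begin

abbreviation f :: "real \<Rightarrow> ennreal" where "f \<equiv> pos_tail \<beta>"

definition Q :: "real \<Rightarrow> ennreal" where
  "Q u = (\<integral>\<^sup>+y. f y * indicator {u<..} y \<partial>lborel)"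

lemma space_beta [simp]: "space \<beta> = UNIV"
  using sets_eq_imp_space_eq[OF sets_beta] by simp

lemma f_measurable [measurable]: "f \<in> borel_measurable borel"
proof -
  have [measurable]: "(\<lambda>y. emeasure \<beta> {y<..}) \<in> borel_measurable borel"
    by (rule borel_measurable_emeasure_antimono) auto
  show ?thesis
    unfolding pos_tail_def by measurable
qed

lemma cdf_measurable [measurable]: "(\<lambda>y. emeasure \<beta> {..y}) \<in> borel_measurable borel"
  by (rule borel_measurable_emeasure_mono) auto

lemma Q_measurable [measurable]: "Q \<in> borel_measurable borel"
proof -
  have "Q = (\<lambda>u. \<integral>\<^sup>+y. f y * indicator {0<..} (y - u) \<partial>lborel)"
    unfolding Q_def by (intro ext nn_integral_cong) (auto simp: indicator_def)
  then show ?thesis by simp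
qed

lemma Q_antimono: "u \<le> v \<Longrightarrow> Q v \<le> Q u"
  unfolding Q_def by (intro nn_integral_mono) (auto simp: indicator_def)

lemma Q_split: "u \<le> v \<Longrightarrow> (\<integral>\<^sup>+y. f y * indicator {u<..v} y \<partial>lborel) + Q v = Q u"
  unfolding Q_def by (subst nn_integral_add[symmetric]) (auto intro!: nn_integral_cong simp: indicator_def)

lemma mean_split: "(\<integral>\<^sup>+y. f y * indicator {..u} y \<partial>lborel) + Q u = ennreal m"
  unfolding Q_def mean[symmetric]
  by (subst nn_integral_add[symmetric]) (auto intro!: nn_integral_cong simp: indicator_def)

lemma Q_nonpos: "u \<le> 0 \<Longrightarrow> Q u = ennreal m"
  unfolding Q_def mean[symmetric]
  by (intro nn_integral_cong_AE, rule AE_mp[OF AE_lborel_singleton[of 0]])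
     (auto simp: pos_tail_def indicator_def)

lemma Q_le_mean: "Q u \<le> ennreal m"
  using Q_antimono[of "min u 0" u] Q_nonpos[of "min u 0"] by simp

lemma Q_pos: "Q u \<noteq> 0"
proof
  assume "Q u = 0"
  then have "AE y in lborel. f y * indicator {u<..} y = 0"
    unfolding Q_def by (subst (asm) nn_integral_0_iff_AE) auto
  then have "AE y in lborel. y \<notin> {max 0 u<..}"
    by eventually_elim (auto simp: pos_tail_def tail_pos indicator_def split: if_splits)
  then have "emeasure lborel {max 0 u<..} = 0"
    by (subst (asm) AE_iff_measurable[of "{max 0 u<..}"]) auto
  moreover have "emeasure lborel {max 0 u<..max 0 u + 1} \<le> emeasure lborel {max 0 u<..}"
    by (intro emeasure_mono) auto
  ultimately show False
    by simp
qed

lemma m_pos: "0 < m"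
  using Q_pos[of 0] Q_nonpos[of 0] by (auto simp: ennreal_eq_0_iff)

definition q :: "real \<Rightarrow> real" where "q u = enn2real (Q u)"

lemma Q_eq_q: "Q u = ennreal (q u)"
  unfolding q_def using Q_le_mean[of u] by (metis ennreal_enn2real ennreal_less_top le_less_trans)

lemma q_pos: "0 < q u"
  using Q_pos[of u] by (simp add: Q_eq_q ennreal_eq_0_iff)

lemma q_le_mean: "q u \<le> m"
  using Q_le_mean[of u] m_pos q_pos[of u] by (simp add: Q_eq_q ennreal_le_iff)

lemma q_antimono: "u \<le> v \<Longrightarrow> q v \<le> q u"
  using Q_antimono[of u v] q_pos by (simp add: Q_eq_q ennreal_le_iff less_imp_le)

text \<open>Dominated convergence applies along the integers; monotonicity of \<open>q\<close> fills
  in the real arguments.\<close>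

lemma q_tendsto_0: "(q \<longlongrightarrow> 0) at_top"
proof -
  have "(\<lambda>n. \<integral>\<^sup>+y. f y * indicator {real n<..} y \<partial>lborel) \<longlonglongrightarrow> integral\<^sup>N (lborel :: real measure) (\<lambda>_. 0)"
  proof (rule nn_integral_dominated_convergence[where w = f])
    show "AE x in lborel. (\<lambda>i. f x * indicator {real i<..} x) \<longlonglongrightarrow> 0"
    proof (rule AE_I2)
      fix x :: real
      have "eventually (\<lambda>i. f x * indicator {real i<..} x = 0) sequentially"
        using eventually_ge_at_top[of "nat \<lceil>x\<rceil>"] by eventually_elim (auto simp: indicator_def nat_le_iff ceiling_le_iff)
      then show "(\<lambda>i. f x * indicator {real i<..} x) \<longlonglongrightarrow> 0"
        by (rule tendsto_eventually)
    qed
  qed (auto simp: mean indicator_def)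
  then have "(\<lambda>n. ennreal (q (real n))) \<longlonglongrightarrow> ennreal 0"
    unfolding Q_eq_q[symmetric] Q_def by simp
  then have lim: "(\<lambda>n. q (real n)) \<longlonglongrightarrow> 0"
    by (subst (asm) tendsto_ennreal_iff) (auto intro!: always_eventually less_imp_le[OF q_pos])
  show ?thesis
  proof (rule order_tendstoI)
    fix e :: real assume "0 < e"
    with lim have "eventually (\<lambda>n. q (real n) < e) sequentially"
      by (rule order_tendstoD)
    then obtain n where "q (real n) < e"
      by (auto simp: eventually_sequentially)
    then show "\<forall>\<^sub>F u in at_top. q u < e"
      using q_antimono by (intro eventually_at_top_linorderI[of "real n"]) (meson le_less_trans)
  qed (auto intro!: always_eventually intro: less_trans[OF _ q_pos])
qed

lemma mean_split_real: "(\<integral>\<^sup>+y. f y * indicator {..u} y \<partial>lborel) = ennreal (m - q u)"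
proof -
  have "(\<integral>\<^sup>+y. f y * indicator {..u} y \<partial>lborel) + ennreal (q u) = ennreal (m - q u) + ennreal (q u)"
    using mean_split[of u] q_pos[of u] q_le_mean[of u] by (simp add: Q_eq_q flip: ennreal_plus)
  then show ?thesis by simp
qed

lemma q_split: "u \<le> v \<Longrightarrow> (\<integral>\<^sup>+y. f y * indicator {u<..v} y \<partial>lborel) = ennreal (q u - q v)"
proof -
  assume uv: "u \<le> v"
  have "(\<integral>\<^sup>+y. f y * indicator {u<..v} y \<partial>lborel) + ennreal (q v) = ennreal (q u - q v) + ennreal (q v)"
    using Q_split[OF uv] q_pos[of v] q_antimono[OF uv] by (simp add: Q_eq_q flip: ennreal_plus)
  then show ?thesis by simp
qed

text \<open>Integrating the defining relation of \<open>S_star\<close> over \<open>(u, \<infinity>)\<close> shows that the integrated tail is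
  subexponential.\<close>

lemma convolution_Q:
  assumes e: "0 < e"
  shows "\<forall>\<^sub>F u in at_top. (\<integral>\<^sup>+y. f y * (Q (u - y) * indicator {..u} y) \<partial>lborel) \<le> ennreal ((m + e) * q u)"
proof -
  obtain x0 where x0: "\<And>x. x \<ge> x0 \<Longrightarrow> (\<integral>\<^sup>+y. f (x - y) * f y \<partial>lborel) \<le> ennreal (2 * m + e) * f x"
    using self_convolution[OF e] by (auto simp: eventually_at_top_linorder)
  show ?thesis
  proof (rule eventually_at_top_linorderI[of "max 0 x0"])
    fix u assume u: "max 0 x0 \<le> u"
    \<comment> \<open>For y > u the argument u - y is negative and Q(u - y) = m, so this part of the
      full-line integral is exactly m Q(u). It uses up one m of the 2m in the hypothesis.\<close>
    have "(\<integral>\<^sup>+y. f y * (Q (u - y) * indicator {..u} y) \<partial>lborel) + ennreal m * Q u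
      = (\<integral>\<^sup>+y. f y * Q (u - y) \<partial>lborel)"
    proof -
      have "ennreal m * Q u = (\<integral>\<^sup>+y. f y * (Q (u - y) * indicator {u<..} y) \<partial>lborel)"
        unfolding Q_def[of u]
        by (subst nn_integral_cmult[symmetric])
           (auto intro!: nn_integral_cong simp: indicator_def Q_nonpos mult.commute)
      then show ?thesis
        by (auto simp: nn_integral_add[symmetric] indicator_def intro!: nn_integral_cong)
    qed
    also have "\<dots> = (\<integral>\<^sup>+y. \<integral>\<^sup>+x. f y * (f (x - y) * indicator {u<..} x) \<partial>lborel \<partial>lborel)"
    proof (intro nn_integral_cong)
      fix y
      have "Q (u - y) = (\<integral>\<^sup>+x. f (x - y) * indicator {u<..} x \<partial>lborel)"
        unfolding Q_def by (subst nn_integral_real_affine[where c = 1 and t = "-y"])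
           (auto intro!: nn_integral_cong simp: indicator_def)
      then show "f y * Q (u - y) = (\<integral>\<^sup>+x. f y * (f (x - y) * indicator {u<..} x) \<partial>lborel)"
        by (simp add: nn_integral_cmult)
    qed
    also have "\<dots> = (\<integral>\<^sup>+x. \<integral>\<^sup>+y. f y * (f (x - y) * indicator {u<..} x) \<partial>lborel \<partial>lborel)"
      by (rule lborel_pair.Fubini') measurable
    also have "\<dots> = (\<integral>\<^sup>+x. (\<integral>\<^sup>+y. f (x - y) * f y \<partial>lborel) * indicator {u<..} x \<partial>lborel)"
      by (intro nn_integral_cong, subst nn_integral_multc[symmetric])
         (auto intro!: nn_integral_cong simp: mult_ac)
    also have "\<dots> \<le> (\<integral>\<^sup>+x. ennreal (2 * m + e) * (f x * indicator {u<..} x) \<partial>lborel)"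
      using u x0 by (intro nn_integral_mono) (auto simp: indicator_def)
    also have "\<dots> = ennreal ((2 * m + e) * q u)"
      using m_pos e q_pos[of u] Q_eq_q[of u] by (simp add: nn_integral_cmult Q_def ennreal_mult)
    also have "\<dots> = ennreal ((m + e) * q u) + ennreal m * Q u"
      using m_pos e q_pos[of u] by (simp add: Q_eq_q ring_distribs flip: ennreal_mult ennreal_plus)
    finally show "(\<integral>\<^sup>+y. f y * (Q (u - y) * indicator {..u} y) \<partial>lborel) \<le> ennreal ((m + e) * q u)"
      by (simp add: Q_eq_q ennreal_mult_eq_top_iff)
  qed
qed

text \<open>Subexponentiality implies long-tailedness. Cut the convolution at y = A:
  \<open>Q (u - y)\<close> is at least \<open>Q u\<close> on [0, A] and at least
  \<open>Q (u - A)\<close> on (A, u]. Against the upper bound (m + e) q(u) this leaves (q(A) - q(u))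
  q(u - A) \<le> (q(A) + e) q(u), and the positive factor q(A) drops out as u grows and e
  shrinks.\<close>

lemma q_long_tailed:
  assumes A: "0 \<le> A"
  shows "((\<lambda>u. q (u - A) / q u) \<longlongrightarrow> 1) at_top"
proof -
  have bound: "\<forall>\<^sub>F u in at_top. q (u - A) / q u \<le> (q A + e) / (q A - e)" if e: "0 < e" "e < q A" for e
    using convolution_Q[OF e(1)] eventually_ge_at_top[of A] order_tendstoD(2)[OF q_tendsto_0 e(1)]
  proof eventually_elim
    case (elim u)
    have "ennreal ((m - q A) * q u + (q A - q u) * q (u - A))
      = (\<integral>\<^sup>+y. f y * indicator {..A} y \<partial>lborel) * Q u + (\<integral>\<^sup>+y. f y * indicator {A<..u} y \<partial>lborel) * Q (u - A)"
      using elim q_pos[of u] q_pos[of "u-A"] q_antimono[of A u] q_le_mean[of A]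
      by (simp add: mean_split_real q_split Q_eq_q ennreal_mult ennreal_plus)
    also have "\<dots> = (\<integral>\<^sup>+y. f y * indicator {..A} y * Q u + f y * indicator {A<..u} y * Q (u - A) \<partial>lborel)"
      by (simp add: nn_integral_add nn_integral_multc)
    also have "\<dots> \<le> (\<integral>\<^sup>+y. f y * (Q (u - y) * indicator {..u} y) \<partial>lborel)"
    proof (intro nn_integral_mono)
      fix y show "f y * indicator {..A} y * Q u + f y * indicator {A<..u} y * Q (u - A)
        \<le> f y * (Q (u - y) * indicator {..u} y)"
        using Q_antimono[of "u - y" u] Q_antimono[of "u - y" "u - A"] elim(2)
        by (cases "y < 0") (auto simp: indicator_def pos_tail_def intro!: mult_left_mono)
    qed
    also have "\<dots> \<le> ennreal ((m + e) * q u)" by (rule elim)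
    finally have "(m - q A) * q u + (q A - q u) * q (u - A) \<le> (m + e) * q u"
      using m_pos e q_pos[of u] by (subst (asm) ennreal_le_iff) auto
    then have "(q A - q u) * q (u - A) \<le> (q A + e) * q u" by (simp add: algebra_simps)
    moreover have "(q A - e) * q (u - A) \<le> (q A - q u) * q (u - A)"
      using elim q_pos[of "u - A"] by (intro mult_right_mono) auto
    ultimately have "(q A - e) * q (u - A) \<le> (q A + e) * q u" by linarith
    then show ?case using e q_pos[of u] by (simp add: field_simps)
  qed
  show ?thesis
  proof (rule tendstoI)
    fix d :: real assume d: "0 < d"
    have "((\<lambda>e. (q A + e) / (q A - e)) \<longlongrightarrow> (q A + 0) / (q A - 0)) (at_right 0)"
      using q_pos[of A] by (intro tendsto_intros) auto
    then have "\<forall>\<^sub>F e in at_right 0. (q A + e) / (q A - e) < 1 + d"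
      using d q_pos[of A] by (intro order_tendstoD) auto
    moreover have "\<forall>\<^sub>F e in at_right 0. e \<in> {0<..<q A}"
      using q_pos[of A] by (rule eventually_at_right_real)
    ultimately have "\<forall>\<^sub>F e in at_right 0. 0 < e \<and> e < q A \<and> (q A + e) / (q A - e) < 1 + d"
      by eventually_elim auto
    then obtain e where e: "0 < e" "e < q A" "(q A + e) / (q A - e) < 1 + d"
      using eventually_happens[of _ "at_right (0::real)"] by (auto simp: trivial_limit_at_right_real)
    show "\<forall>\<^sub>F u in at_top. dist (q (u - A) / q u) 1 < d"
      using bound[OF e(1,2)]
    proof eventually_elim
      case (elim u)
      have "1 \<le> q (u - A) / q u"
        using q_antimono[of "u - A" u] A q_pos[of u] by simp
      then show ?case using elim e(3) by (simp add: dist_real_def)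
    qed
  qed
qed

subsection \<open>The renewal equation\<close>

text \<open>Picard iteration from zero. For u \<ge> 0 the n-th iterate is the probability that a
  renewal process with defective step density \<open>a f\<close> passes u within n steps. The value
  0 on negative arguments confines the convolution to y \<le> u, and monotonicity in n settles
  convergence.\<close>

fun renewal_iter :: "nat \<Rightarrow> real \<Rightarrow> ennreal" where
  "renewal_iter 0 u = 0"
| "renewal_iter (Suc n) u =
    (if u < 0 then 0 else ennreal a * (Q u + (\<integral>\<^sup>+y. f y * renewal_iter n (u - y) \<partial>lborel)))"

definition g :: "real \<Rightarrow> ennreal" where
  "g u = (SUP n. renewal_iter n u)"

lemma renewal_iter_measurable [measurable]: "renewal_iter n \<in> borel_measurable borel"
proof (induction n)
  case 0
  have "renewal_iter 0 = (\<lambda>u. 0)" by auto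
  then show ?case by simp
next
  case (Suc n)
  note [measurable] = Suc
  have "renewal_iter (Suc n) = (\<lambda>u. if u < 0 then 0 else
      ennreal a * (Q u + (\<integral>\<^sup>+y. f y * renewal_iter n (u - y) \<partial>lborel)))"
    by auto
  then show ?case by simp
qed

lemma g_measurable [measurable]: "g \<in> borel_measurable borel"
  unfolding g_def[abs_def] by measurable

lemma renewal_iter_neg: "u < 0 \<Longrightarrow> renewal_iter n u = 0"
  by (cases n) auto

lemma renewal_iter_le_Suc: "renewal_iter n u \<le> renewal_iter (Suc n) u"
proof (induction n arbitrary: u)
  case (Suc n)
  have "(\<integral>\<^sup>+y. f y * renewal_iter n (u - y) \<partial>lborel) \<le> (\<integral>\<^sup>+y. f y * renewal_iter (Suc n) (u - y) \<partial>lborel)"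
    by (intro nn_integral_mono mult_left_mono Suc) auto
  then show ?case
    unfolding renewal_iter.simps(2)[of n] renewal_iter.simps(2)[of "Suc n"]
    by (auto intro!: mult_left_mono add_left_mono)
qed simp

lemma renewal_iter_mono: "incseq (\<lambda>n. renewal_iter n u)"
  by (intro incseq_SucI renewal_iter_le_Suc)

text \<open>If the previous iterate is at most 1, the bracket is at most Q(u) plus the mass of
  \<open>f\<close> on [0, u], which is m; and a m < 1.\<close>

lemma renewal_iter_le_1: "renewal_iter n u \<le> 1"
proof (induction n arbitrary: u)
  case (Suc n)
  show ?case
  proof (cases "u < 0")
    case False
    have "(\<integral>\<^sup>+y. f y * renewal_iter n (u - y) \<partial>lborel) \<le> (\<integral>\<^sup>+y. f y * indicator {..u} y \<partial>lborel)"
      using Suc mult_left_mono[OF Suc] by (intro nn_integral_mono) (auto simp: indicator_def renewal_iter_neg)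
    then have "Q u + (\<integral>\<^sup>+y. f y * renewal_iter n (u - y) \<partial>lborel) \<le> ennreal m"
      using mean_split[of u] by (metis add.commute add_left_mono)
    then have "ennreal a * (Q u + (\<integral>\<^sup>+y. f y * renewal_iter n (u - y) \<partial>lborel)) \<le> ennreal a * ennreal m"
      by (intro mult_left_mono) auto
    also have "\<dots> \<le> 1"
      using a_pos m_pos am by (simp add: ennreal_le_1 flip: ennreal_mult)
    finally show ?thesis using False by simp
  qed simp
qed simp

lemma g_neg: "u < 0 \<Longrightarrow> g u = 0"
  by (simp add: g_def renewal_iter_neg)

lemma g_le_1: "g u \<le> 1"
  unfolding g_def by (intro SUP_least renewal_iter_le_1)

lemma g_renewal:
  assumes "0 \<le> u"
  shows "g u = ennreal a * (Q u + (\<integral>\<^sup>+y. f y * g (u - y) \<partial>lborel))"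
proof -
  have "(\<integral>\<^sup>+y. f y * g (u - y) \<partial>lborel) = (\<integral>\<^sup>+y. (SUP n. f y * renewal_iter n (u - y)) \<partial>lborel)"
    by (simp add: g_def SUP_mult_left_ennreal)
  also have "\<dots> = (SUP n. \<integral>\<^sup>+y. f y * renewal_iter n (u - y) \<partial>lborel)"
    using renewal_iter_mono
    by (intro nn_integral_monotone_convergence_SUP)
       (auto simp: incseq_def le_fun_def intro!: mult_left_mono)
  finally have "ennreal a * (Q u + (\<integral>\<^sup>+y. f y * g (u - y) \<partial>lborel)) = (SUP n. renewal_iter (Suc n) u)"
    using assms by (simp add: ennreal_SUP_add_right SUP_mult_left_ennreal)
  also have "\<dots> = g u"
    unfolding g_def using renewal_iter_mono
    by (intro antisym SUP_least SUP_upper UNIV_I)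
       (auto intro!: SUP_upper2 simp del: renewal_iter.simps intro: renewal_iter_le_Suc)
  finally show ?thesis by simp
qed

text \<open>The bound \<open>K q\<close> is invariant under the iteration. Beyond \<open>x0\<close>
  a convolution with Q costs at most the factor m + e, and a + K r \<le> K restores K; up to
  \<open>x0\<close> the trivial bound 1 suffices, because \<open>q\<close> stays above
  \<open>q x0\<close> there. The two entries of the maximum defining \<open>K\<close> serve these
  two ranges.\<close>

lemma g_le_Q: "\<exists>K>0. \<forall>u. g u \<le> ennreal (K * q u)"
proof -
  \<comment> \<open>Chosen so that r = a (m + e) is the midpoint of a m and 1.\<close>
  define e where "e = (1 - a * m) / (2 * a)"
  define r where "r = a * (m + e)"
  have e: "0 < e" using am a_pos by (simp add: e_def)
  have "0 < r" using a_pos m_pos e by (simp add: r_def)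
  moreover have "r = (1 + a * m) / 2" using a_pos by (simp add: r_def e_def field_simps)
  ultimately have r: "0 < r" "r < 1" using am by simp_all
  obtain x0 where x0: "\<And>u. u \<ge> x0 \<Longrightarrow>
      (\<integral>\<^sup>+y. f y * (Q (u - y) * indicator {..u} y) \<partial>lborel) \<le> ennreal ((m + e) * q u)"
    using convolution_Q[OF e] by (auto simp: eventually_at_top_linorder)
  define K where "K = max (1 / q x0) (a / (1 - r))"
  have K: "0 < K" "1 \<le> K * q x0" "a + K * r \<le> K"
  proof -
    show "0 < K" using q_pos[of x0] by (simp add: K_def less_max_iff_disj)
    have "(1 / q x0) * q x0 \<le> K * q x0" 
      using q_pos[of x0] by (intro mult_right_mono) (auto simp: K_def)
    then show "1 \<le> K * q x0" using q_pos[of x0] by simp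
    have "a / (1 - r) \<le> K" by (simp add: K_def)
    then show "a + K * r \<le> K" using r by (simp add: field_simps)
  qed
  have "renewal_iter n u \<le> ennreal (K * q u)" for n u
  proof (induction n arbitrary: u)
    case (Suc n)
    consider "u < 0" | "0 \<le> u" "u \<le> x0" | "0 \<le> u" "x0 \<le> u" by linarith
    then show ?case
    proof cases
      case 2
      have "1 \<le> K * q u"
        using K q_antimono[OF 2(2)] by (meson less_imp_le mult_left_mono order_trans)
      then show ?thesis
        using renewal_iter_le_1[of "Suc n" u] by (metis ennreal_1 ennreal_leI order_trans)
    next
      case 3
      have "(\<integral>\<^sup>+y. f y * renewal_iter n (u - y) \<partial>lborel)
        \<le> (\<integral>\<^sup>+y. ennreal K * (f y * (Q (u - y) * indicator {..u} y)) \<partial>lborel)"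
      proof (intro nn_integral_mono)
        fix y
        show "f y * renewal_iter n (u - y) \<le> ennreal K * (f y * (Q (u - y) * indicator {..u} y))"
          using mult_left_mono[OF Suc[of "u - y"], of "f y"] K(1) q_pos[of "u - y"]
          by (cases "y \<le> u") (auto simp: renewal_iter_neg Q_eq_q ennreal_mult mult_ac)
      qed
      also have "\<dots> = ennreal K * (\<integral>\<^sup>+y. f y * (Q (u - y) * indicator {..u} y) \<partial>lborel)"
        by (simp add: nn_integral_cmult)
      also have "\<dots> \<le> ennreal K * ennreal ((m + e) * q u)"
        by (intro mult_left_mono x0 3) auto
      finally have "renewal_iter (Suc n) u \<le> ennreal a * (ennreal (q u) + ennreal K * ennreal ((m + e) * q u))"
        using 3 by (auto intro!: mult_left_mono add_left_mono simp: Q_eq_q)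
      also have "\<dots> = ennreal ((a + K * r) * q u)"
        using a_pos m_pos e K(1) q_pos[of u]
        by (simp add: r_def algebra_simps flip: ennreal_mult ennreal_plus)
      also have "\<dots> \<le> ennreal (K * q u)"
        using K(3) q_pos[of u] by (intro ennreal_leI mult_right_mono) auto
      finally show ?thesis .
    qed simp
  qed simp
  then show ?thesis
    using K(1) by (auto simp: g_def intro!: SUP_least exI[of _ K])
qed

text \<open>The assumed bound on g(u - y) holds only for y \<le> u - v. On the remaining strip g
  \<le> 1, and the \<open>f\<close>-mass q(u - v) - q(u) of the strip is negligible against q(u) by
  long-tailedness. The main part is controlled by \<open>convolution_Q\<close>.\<close>

lemma renewal_upper_step:
  assumes c: "0 \<le> c" "\<forall>\<^sub>F u in at_top. g u \<le> ennreal (c * q u)" and e: "0 < e"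
  shows "\<forall>\<^sub>F u in at_top. g u \<le> ennreal ((a + a * m * c + e) * q u)"
proof -
  \<comment> \<open>The errors a c d from the convolution and a d from the strip add up to
    e.\<close>
  define d where "d = e / (a * (c + 1))"
  have d: "0 < d" using a_pos c e by (simp add: d_def)
  obtain v where v: "0 \<le> v" "\<And>u. u \<ge> v \<Longrightarrow> g u \<le> ennreal (c * q u)"
    using c(2) unfolding eventually_at_top_linorder by (metis linorder_linear order_trans)
  have "\<forall>\<^sub>F u in at_top. q (u - v) / q u < 1 + d"
    using q_long_tailed[OF v(1)] d by (intro order_tendstoD) auto
  with convolution_Q[OF d] eventually_ge_at_top[of v] show ?thesis
  proof eventually_elim
    case (elim u)
    have qv: "q (u - v) - q u \<le> d * q u"
      using elim(3) q_pos[of u] by (simp add: field_simps)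
    have "(\<integral>\<^sup>+y. f y * g (u - y) \<partial>lborel)
      \<le> (\<integral>\<^sup>+y. ennreal c * (f y * (Q (u - y) * indicator {..u} y)) + f y * indicator {u - v<..u} y \<partial>lborel)"
    proof (intro nn_integral_mono)
      fix y
      consider "u < y" | "y \<le> u - v" | "u - v < y" "y \<le> u" by linarith
      then show "f y * g (u - y) \<le> ennreal c * (f y * (Q (u - y) * indicator {..u} y)) + f y * indicator {u - v<..u} y"
      proof cases
        case 2
        then show ?thesis
          using mult_left_mono[OF v(2)[of "u - y"], of "f y"] v(1) c(1) q_pos[of "u - y"]
          by (auto simp: Q_eq_q ennreal_mult mult_ac)
      next
        case 3
        then show ?thesis
          using mult_left_mono[OF g_le_1[of "u - y"], of "f y"] by (auto intro: add_increasing)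
      qed (simp add: g_neg)
    qed
    also have "\<dots> = ennreal c * (\<integral>\<^sup>+y. f y * (Q (u - y) * indicator {..u} y) \<partial>lborel) + ennreal (q (u - v) - q u)"
      using v(1) by (simp add: nn_integral_add nn_integral_cmult q_split)
    also have "\<dots> \<le> ennreal c * ennreal ((m + d) * q u) + ennreal (d * q u)"
      using elim qv by (intro add_mono mult_left_mono ennreal_leI) auto
    finally have "g u \<le> ennreal a * (ennreal (q u) + (ennreal c * ennreal ((m + d) * q u) + ennreal (d * q u)))"
      using elim(2) v(1) by (simp add: g_renewal Q_eq_q mult_left_mono add_left_mono)
    also have "\<dots> = ennreal ((a + a * m * c + a * (c + 1) * d) * q u)"
      using a_pos m_pos d c(1) q_pos[of u]
      by (simp add: algebra_simps flip: ennreal_mult ennreal_plus)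
    also have "a * (c + 1) * d = e" using a_pos c(1) by (simp add: d_def)
    finally show ?case .
  qed
qed

text \<open>Dropping the strip y > u - v and using q(u - y) \<ge> q(u) for y \<ge> 0 leaves the
  \<open>f\<close>-mass m - q(u - v), which tends to m. The only loss is a c q(u - v).\<close>

lemma renewal_lower_step:
  assumes c: "0 \<le> c" "\<forall>\<^sub>F u in at_top. ennreal (c * q u) \<le> g u" and e: "0 < e"
  shows "\<forall>\<^sub>F u in at_top. ennreal ((a + a * m * c - e) * q u) \<le> g u"
proof -
  define d where "d = e / (a * (c + 1))"
  have d: "0 < d" using a_pos c e by (simp add: d_def)
  obtain v where v: "0 \<le> v" "\<And>u. u \<ge> v \<Longrightarrow> ennreal (c * q u) \<le> g u"
    using c(2) unfolding eventually_at_top_linorder by (metis linorder_linear order_trans)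
  obtain w where w: "\<And>u. u \<ge> w \<Longrightarrow> q u < d"
    using order_tendstoD(2)[OF q_tendsto_0 d] unfolding eventually_at_top_linorder by blast
  show ?thesis
  proof (rule eventually_at_top_linorderI[of "max v (w + v)"])
    fix u assume u: "max v (w + v) \<le> u"
    have qd: "q (u - v) \<le> d" using w[of "u - v"] u by simp
    have "ennreal c * (ennreal (q u) * ennreal (m - q (u - v)))
       = (\<integral>\<^sup>+y. ennreal c * (ennreal (q u) * (f y * indicator {..u - v} y)) \<partial>lborel)"
      by (simp add: nn_integral_cmult mean_split_real)
    also have "\<dots> \<le> (\<integral>\<^sup>+y. f y * g (u - y) \<partial>lborel)"
    proof (intro nn_integral_mono)
      fix y
      show "ennreal c * (ennreal (q u) * (f y * indicator {..u - v} y)) \<le> f y * g (u - y)"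
      proof (cases "0 \<le> y \<and> y \<le> u - v")
        case True
        have "ennreal c * ennreal (q u) \<le> ennreal (c * q (u - y))"
          using c(1) q_antimono[of "u - y" u] q_pos[of u] True
          by (auto simp flip: ennreal_mult intro!: ennreal_leI mult_left_mono)
        also have "\<dots> \<le> g (u - y)" using True by (intro v(2)) auto
        finally have "ennreal c * ennreal (q u) * f y \<le> g (u - y) * f y" by (rule mult_right_mono) auto
        then show ?thesis using True by (simp add: mult_ac)
      qed (auto simp: pos_tail_def indicator_def)
    qed
    finally have "ennreal a * (ennreal (q u) + ennreal c * (ennreal (q u) * ennreal (m - q (u - v)))) \<le> g u"
      using u v(1) by (simp add: g_renewal Q_eq_q mult_left_mono add_left_mono)
    also have "ennreal a * (ennreal (q u) + ennreal c * (ennreal (q u) * ennreal (m - q (u - v))))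
      = ennreal (a * (q u + c * (q u * (m - q (u - v)))))"
      using a_pos c(1) q_pos[of u] q_le_mean[of "u - v"] by (simp flip: ennreal_mult ennreal_plus)
    also have "a * (q u + c * (q u * (m - q (u - v)))) = (a + a * m * c - a * c * q (u - v)) * q u"
      by (simp add: algebra_simps)
    finally have *: "ennreal ((a + a * m * c - a * c * q (u - v)) * q u) \<le> g u" .
    have "a * c * q (u - v) \<le> a * (c + 1) * d"
      using qd q_pos[of "u - v"] a_pos c(1) d by (intro mult_mono) auto
    also have "\<dots> = e" using a_pos c(1) by (simp add: d_def)
    finally have "(a + a * m * c - e) * q u \<le> (a + a * m * c - a * c * q (u - v)) * q u"
      using q_pos[of u] by (intro mult_right_mono) auto
    then show "ennreal ((a + a * m * c - e) * q u) \<le> g u"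
      using * ennreal_leI order_trans by blast
  qed
qed

text \<open>The step lemmas iterate affine maps sending c to a + a m c + e or a + a m c - e,
  contractions with factor a m. Their fixed points can be placed arbitrarily close to a / (1 - a m)
  on either side.\<close>

lemma g_asymp: "((\<lambda>u. enn2real (g u) / q u) \<longlongrightarrow> a / (1 - a * m)) at_top"
proof -
  have am0: "0 < a * m" using a_pos m_pos by simp
  have upper: "\<forall>\<^sub>F u in at_top. enn2real (g u) / q u < x" if x: "a / (1 - a * m) < x" for x
  proof -
    obtain y where y: "a / (1 - a * m) < y" "y < x" using x dense by blast
    \<comment> \<open>Makes y the fixed point of the perturbed map, so that n steps turn the initial
      constant y + K into y + (a m)^n K.\<close>
    define e where "e = y * (1 - a * m) - a"
    have e: "0 < e" using y(1) am by (simp add: e_def field_simps)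
    obtain K where K: "0 < K" "\<And>u. g u \<le> ennreal (K * q u)" using g_le_Q by blast
    have y0: "0 \<le> y" using y a_pos am by (smt (verit) divide_pos_pos)
    have *: "\<forall>\<^sub>F u in at_top. g u \<le> ennreal ((y + (a * m) ^ n * K) * q u)" for n
    proof (induction n)
      case 0
      have "g u \<le> ennreal ((y + K) * q u)" for u
        using K(2)[of u] y0 q_pos[of u] K(1) by (auto intro: order_trans ennreal_leI simp: ring_distribs)
      then show ?case by simp
    next
      case (Suc n)
      have "a + a * m * (y + (a * m) ^ n * K) + e = y + (a * m) ^ Suc n * K"
        by (simp add: e_def algebra_simps)
      with renewal_upper_step[OF _ Suc e] show ?case using y0 am0 K(1) by simp
    qed
    have "(\<lambda>n. y + (a * m) ^ n * K) \<longlonglongrightarrow> y + 0 * K"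
      using am0 am by (intro tendsto_intros LIMSEQ_power_zero) auto
    then have "\<forall>\<^sub>F n in sequentially. y + (a * m) ^ n * K < x"
      using y(2) by (intro order_tendstoD) auto
    then obtain n where n: "y + (a * m) ^ n * K < x" by (auto simp: eventually_sequentially)
    show ?thesis using *[of n]
    proof eventually_elim
      case (elim u)
      have "enn2real (g u) \<le> (y + (a * m) ^ n * K) * q u"
        using elim y0 am0 K(1) q_pos[of u] by (intro enn2real_leI) auto
      then have "enn2real (g u) / q u \<le> y + (a * m) ^ n * K" using q_pos[of u] by (simp add: field_simps)
      then show ?case using n by simp
    qed
  qed
  have lower: "\<forall>\<^sub>F u in at_top. x < enn2real (g u) / q u" if x: "x < a / (1 - a * m)" for x
  proof -
    obtain y where y: "max x 0 < y" "y < a / (1 - a * m)"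
      using x dense[of "max x 0" "a / (1 - a * m)"] a_pos am by auto
    \<comment> \<open>Again y is the fixed point, now of the map with - e. The iteration starts from
      y - y = 0, a trivial lower bound, and y > 0 keeps all constants nonnegative.\<close>
    define e where "e = a - y * (1 - a * m)"
    have e: "0 < e" using y(2) am by (simp add: e_def field_simps)
    have *: "\<forall>\<^sub>F u in at_top. ennreal ((y - (a * m) ^ n * y) * q u) \<le> g u" for n
    proof (induction n)
      case (Suc n)
      have "a + a * m * (y - (a * m) ^ n * y) - e = y - (a * m) ^ Suc n * y"
        by (simp add: e_def algebra_simps)
      moreover have "0 \<le> y - (a * m) ^ n * y"
        using y am0 am by (simp add: mult_left_le_one_le power_le_one)
      ultimately show ?case using renewal_lower_step[OF _ Suc e] by simp
    qed simp
    have "(\<lambda>n. y - (a * m) ^ n * y) \<longlonglongrightarrow> y - 0 * y"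
      using am0 am by (intro tendsto_intros LIMSEQ_power_zero) auto
    then have "\<forall>\<^sub>F n in sequentially. x < y - (a * m) ^ n * y"
      using y(1) by (intro order_tendstoD) auto
    then obtain n where n: "x < y - (a * m) ^ n * y" by (auto simp: eventually_sequentially)
    show ?thesis using *[of n]
    proof eventually_elim
      case (elim u)
      have "g u < top" using g_le_1[of u] by (auto intro: le_less_trans)
      then have "(y - (a * m) ^ n * y) * q u \<le> enn2real (g u)"
        using elim by (cases "g u") (auto simp: ennreal_le_iff)
      then have "y - (a * m) ^ n * y \<le> enn2real (g u) / q u" using q_pos[of u] by (simp add: field_simps)
      then show ?case using n by simp
    qed
  qed
  show ?thesis by (rule order_tendstoI) (use upper lower in auto)
qed

end

subsection \<open>From the renewal equation to the random walk\<close>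

lemma nn_integral_cong_except:
  fixes c :: real
  assumes "\<And>x. x \<noteq> c \<Longrightarrow> F x = G x"
  shows "(\<integral>\<^sup>+x. F x \<partial>lborel) = (\<integral>\<^sup>+x. G x \<partial>lborel)"
  by (rule nn_integral_cong_AE, rule AE_mp[OF AE_lborel_singleton[of c]]) (simp add: assms)

lemma nn_integral_exponential_tail:
  assumes a: "0 < a" and x: "0 \<le> x"
  shows "(\<integral>\<^sup>+s. ennreal (exponential_density a s) * indicator {x..} s \<partial>lborel) = ennreal (exp (- a * x))"
proof -
  have "(\<integral>\<^sup>+s. ennreal (exponential_density a s) * indicator {x..} s \<partial>lborel)
    = (\<integral>\<^sup>+s. ennreal (a * exp (- a * s)) * indicator {x..} s \<partial>lborel)"
    using x by (intro nn_integral_cong) (auto simp: exponential_density_def indicator_def mult.commute)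
  also have "\<dots> = ennreal (0 - (- exp (- a * x)))"
  proof (rule nn_integral_FTC_atLeast)
    have "((\<lambda>s. - exp (- a * s)) \<longlongrightarrow> - 0) at_top"
      using a by (intro tendsto_minus filterlim_compose[OF exp_at_bot] filterlim_tendsto_neg_mult_at_bot[OF tendsto_const])
        (auto intro: filterlim_ident)
    then show "((\<lambda>s. - exp (- a * s)) \<longlongrightarrow> 0) at_top" by simp
  qed (use a in \<open>auto intro!: derivative_eq_intros\<close>)
  finally show ?thesis by simp
qed

lemma nn_integral_exponential_density:
  assumes "0 < a"
  shows "(\<integral>\<^sup>+s. ennreal (exponential_density a s) \<partial>lborel) = 1"
proof -
  have "(\<integral>\<^sup>+s. ennreal (exponential_density a s) \<partial>lborel)
    = (\<integral>\<^sup>+s. ennreal (exponential_density a s) * indicator {0..} s \<partial>lborel)"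
    by (intro nn_integral_cong) (auto simp: exponential_density_def indicator_def)
  then show ?thesis using nn_integral_exponential_tail[OF assms, of 0] by simp
qed

text \<open>Integration by parts for the exponential law, done by Fubini: the value of \<phi> at u +
  x is weighted with the probability exp(- a x) that s \<ge> x, and a exp(- a x) is the density
  itself.\<close>

lemma nn_integral_exponential_primitive:
  fixes \<phi> :: "real \<Rightarrow> ennreal"
  assumes a: "0 < a" and [measurable]: "\<phi> \<in> borel_measurable borel"
  shows "ennreal a * (\<integral>\<^sup>+s. ennreal (exponential_density a s) * (\<integral>\<^sup>+x. \<phi> x * indicator {u<..u + s} x \<partial>lborel) \<partial>lborel)
    = (\<integral>\<^sup>+s. ennreal (exponential_density a s) * \<phi> (u + s) \<partial>lborel)"
proof -
  let ?w = "\<lambda>s. ennreal (exponential_density a s)"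
  have "(\<integral>\<^sup>+s. ?w s * (\<integral>\<^sup>+x. \<phi> x * indicator {u<..u + s} x \<partial>lborel) \<partial>lborel)
    = (\<integral>\<^sup>+s. \<integral>\<^sup>+x. ?w s * (\<phi> (u + x) * (indicator {0<..} x * indicator {0..} (s - x))) \<partial>lborel \<partial>lborel)"
  proof (intro nn_integral_cong)
    fix s
    have "(\<integral>\<^sup>+x. \<phi> x * indicator {u<..u + s} x \<partial>lborel)
      = (\<integral>\<^sup>+x. \<phi> (u + x) * (indicator {0<..} x * indicator {0..} (s - x)) \<partial>lborel)"
      by (subst nn_integral_real_affine[where c = 1 and t = u])
         (auto intro!: nn_integral_cong simp: indicator_def)
    then show "?w s * (\<integral>\<^sup>+x. \<phi> x * indicator {u<..u + s} x \<partial>lborel)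
      = (\<integral>\<^sup>+x. ?w s * (\<phi> (u + x) * (indicator {0<..} x * indicator {0..} (s - x))) \<partial>lborel)"
      by (simp add: nn_integral_cmult)
  qed
  also have "\<dots> = (\<integral>\<^sup>+x. \<integral>\<^sup>+s. ?w s * (\<phi> (u + x) * (indicator {0<..} x * indicator {0..} (s - x))) \<partial>lborel \<partial>lborel)"
    by (rule lborel_pair.Fubini') measurable
  also have "\<dots> = (\<integral>\<^sup>+x. \<phi> (u + x) * indicator {0<..} x * (\<integral>\<^sup>+s. ?w s * indicator {x..} s \<partial>lborel) \<partial>lborel)"
    by (intro nn_integral_cong, subst nn_integral_cmult[symmetric])
       (auto intro!: nn_integral_cong simp: indicator_def mult.commute)
  also have "\<dots> = (\<integral>\<^sup>+x. \<phi> (u + x) * indicator {0<..} x * ennreal (exp (- a * x)) \<partial>lborel)"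
    using nn_integral_exponential_tail[OF a] by (intro nn_integral_cong) (auto simp: indicator_def)
  finally have "ennreal a * (\<integral>\<^sup>+s. ?w s * (\<integral>\<^sup>+x. \<phi> x * indicator {u<..u + s} x \<partial>lborel) \<partial>lborel)
    = (\<integral>\<^sup>+x. ennreal a * (\<phi> (u + x) * indicator {0<..} x * ennreal (exp (- a * x))) \<partial>lborel)"
    by (simp add: nn_integral_cmult)
  also have "\<dots> = (\<integral>\<^sup>+s. ?w s * \<phi> (u + s) \<partial>lborel)"
  proof (rule nn_integral_cong_except[of 0])
    fix x :: real assume x: "x \<noteq> 0"
    show "ennreal a * (\<phi> (u + x) * indicator {0<..} x * ennreal (exp (- a * x))) = ?w x * \<phi> (u + x)"
    proof (cases "x < 0")
      case False
      then have "?w x = ennreal a * ennreal (exp (- a * x))"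
        using a by (simp add: exponential_density_def mult.commute flip: ennreal_mult)
      with x False show ?thesis by (simp add: mult_ac)
    qed (simp add: exponential_density_def)
  qed
  finally show ?thesis .
qed

section \<open>Backward equation and one-step equation for g\<close>

context integrated_tail
begin

text \<open>Mean value after a claim that arrives at surplus v. The functions inserted are meant to
  be 0 on the negative half-line; the indicator supplies the value 1 that ruin has there, and makes
  the operator affine.\<close>

definition step_mean :: "(real \<Rightarrow> ennreal) \<Rightarrow> real \<Rightarrow> ennreal" where
  "step_mean \<phi> v = (\<integral>\<^sup>+b. \<phi> (v - b) + indicator {..<0} (v - b) \<partial>\<beta>)"

lemma step_mean_measurable [measurable]:
  assumes [measurable]: "\<phi> \<in> borel_measurable borel"
  shows "step_mean \<phi> \<in> borel_measurable borel"
  unfolding step_mean_def[abs_def] by measurable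

lemma nonneg_AE: "AE b in \<beta>. 0 \<le> b"
  by (rule AE_I[of _ _ "{..<0}"]) (auto simp: nonneg)

lemma f_add_cdf: "f z + emeasure \<beta> {..z} = indicator {0..} z"
proof (cases "0 \<le> z")
  case True
  have "f z + emeasure \<beta> {..z} = emeasure \<beta> ({z<..} \<union> {..z})"
    using True by (subst plus_emeasure[symmetric]) (auto simp: pos_tail_def)
  also have "{z<..} \<union> {..z} = space \<beta>" by auto
  finally show ?thesis using True emeasure_space_1 by simp
next
  case False
  have "emeasure \<beta> {..z} \<le> emeasure \<beta> {..<0}" using False by (intro emeasure_mono) auto
  then show ?thesis using False by (simp add: nonneg pos_tail_def)
qed

lemma step_mean_g_eq:
  assumes "0 \<le> v"
  shows "step_mean g v = f v + (\<integral>\<^sup>+b. g (v - b) \<partial>\<beta>)"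
proof -
  have "step_mean g v = (\<integral>\<^sup>+b. g (v - b) \<partial>\<beta>) + (\<integral>\<^sup>+b. indicator {v<..} b \<partial>\<beta>)"
    unfolding step_mean_def by (subst nn_integral_add[symmetric]) (auto intro!: nn_integral_cong simp: indicator_def)
  then show ?thesis using assms by (simp add: pos_tail_def add.commute)
qed

lemma integral_convolution_beta:
  "(\<integral>\<^sup>+x. (\<integral>\<^sup>+b. g (x - b) \<partial>\<beta>) * indicator {0<..u} x \<partial>lborel) = (\<integral>\<^sup>+y. g y * emeasure \<beta> {..u - y} \<partial>lborel)"
proof -
  interpret pair_sigma_finite lborel \<beta> ..
  have "(\<integral>\<^sup>+x. (\<integral>\<^sup>+b. g (x - b) \<partial>\<beta>) * indicator {0<..u} x \<partial>lborel)
    = (\<integral>\<^sup>+x. \<integral>\<^sup>+b. g (x - b) * indicator {0<..u} x \<partial>\<beta> \<partial>lborel)"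
    by (intro nn_integral_cong, subst nn_integral_multc) auto
  also have "\<dots> = (\<integral>\<^sup>+b. \<integral>\<^sup>+x. g (x - b) * indicator {0<..u} x \<partial>lborel \<partial>\<beta>)"
    by (rule Fubini'[symmetric]) measurable
  also have "\<dots> = (\<integral>\<^sup>+b. \<integral>\<^sup>+y. g y * indicator {..u} (y + b) \<partial>lborel \<partial>\<beta>)"
  proof (rule nn_integral_cong_AE)
    show "AE b in \<beta>. (\<integral>\<^sup>+x. g (x - b) * indicator {0<..u} x \<partial>lborel) = (\<integral>\<^sup>+y. g y * indicator {..u} (y + b) \<partial>lborel)"
      using nonneg_AE
    proof eventually_elim
      case (elim b)
      have "(\<integral>\<^sup>+x. g (x - b) * indicator {0<..u} x \<partial>lborel) = (\<integral>\<^sup>+y. g y * indicator {0<..u} (y + b) \<partial>lborel)"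
        using nn_integral_real_affine[where c = 1 and t = b and f = "\<lambda>x. g (x - b) * indicator {0<..u} x"]
        by (simp add: add.commute[of b])
      also have "\<dots> = (\<integral>\<^sup>+y. g y * indicator {..u} (y + b) \<partial>lborel)"
        using elim by (intro nn_integral_cong_except[of "- b"]) (auto simp: indicator_def g_neg)
      finally show ?case .
    qed
  qed
  also have "\<dots> = (\<integral>\<^sup>+y. \<integral>\<^sup>+b. g y * indicator {..u} (y + b) \<partial>\<beta> \<partial>lborel)"
    by (rule Fubini') measurable
  also have "\<dots> = (\<integral>\<^sup>+y. g y * (\<integral>\<^sup>+b. indicator {..u - y} b \<partial>\<beta>) \<partial>lborel)"
    by (intro nn_integral_cong, subst nn_integral_cmult[symmetric])
       (auto intro!: nn_integral_cong simp: indicator_def)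
  also have "\<dots> = (\<integral>\<^sup>+y. g y * emeasure \<beta> {..u - y} \<partial>lborel)"
    by simp
  finally show ?thesis .
qed

text \<open>The integrated form of the backward equation \<open>g' = a (g - step_mean g)\<close>, arranged without
  subtraction.\<close>

lemma backward_equation:
  assumes u: "0 \<le> u"
  shows "g u + ennreal a * (\<integral>\<^sup>+x. step_mean g x * indicator {0<..u} x \<partial>lborel)
    = ennreal (a * m) + ennreal a * (\<integral>\<^sup>+x. g x * indicator {0<..u} x \<partial>lborel)"
proof -
  have conv: "(\<integral>\<^sup>+y. f y * g (u - y) \<partial>lborel) = (\<integral>\<^sup>+y. g y * f (u - y) \<partial>lborel)"
    using nn_integral_real_affine[where c = "-1" and t = u and f = "\<lambda>y. f y * g (u - y)"]
    by (simp add: mult.commute[of "f _"])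
  \<comment> \<open>Tail and distribution function at u - y add up to 1 for y \<le> u. Hence the
    convolution in the renewal equation and the one produced by \<open>step_mean\<close> merge into
    the plain integral of g.\<close>
  have "(\<integral>\<^sup>+y. g y * f (u - y) \<partial>lborel) + (\<integral>\<^sup>+y. g y * emeasure \<beta> {..u - y} \<partial>lborel)
    = (\<integral>\<^sup>+y. g y * indicator {0..} (u - y) \<partial>lborel)"
  proof -
    have [measurable]: "(\<lambda>y. emeasure \<beta> {..u - y}) \<in> borel_measurable borel"
      by (rule measurable_compose[OF _ cdf_measurable]) measurable
    show ?thesis
      by (subst nn_integral_add[symmetric]) (simp_all only: distrib_left[symmetric] f_add_cdf, measurable)
  qed
  also have "\<dots> = (\<integral>\<^sup>+x. g x * indicator {0<..u} x \<partial>lborel)"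
    by (intro nn_integral_cong_except[of 0]) (auto simp: indicator_def g_neg not_less)
  finally have *: "(\<integral>\<^sup>+y. g y * f (u - y) \<partial>lborel) + (\<integral>\<^sup>+y. g y * emeasure \<beta> {..u - y} \<partial>lborel)
    = (\<integral>\<^sup>+x. g x * indicator {0<..u} x \<partial>lborel)" .
  have "(\<integral>\<^sup>+x. step_mean g x * indicator {0<..u} x \<partial>lborel)
    = (\<integral>\<^sup>+x. f x * indicator {0<..u} x + (\<integral>\<^sup>+b. g (x - b) \<partial>\<beta>) * indicator {0<..u} x \<partial>lborel)"
    by (intro nn_integral_cong) (auto simp: step_mean_g_eq indicator_def)
  also have "\<dots> = (\<integral>\<^sup>+x. f x * indicator {0<..u} x \<partial>lborel) + (\<integral>\<^sup>+y. g y * emeasure \<beta> {..u - y} \<partial>lborel)"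
    by (subst nn_integral_add) (auto simp: integral_convolution_beta)
  finally have "g u + ennreal a * (\<integral>\<^sup>+x. step_mean g x * indicator {0<..u} x \<partial>lborel)
    = ennreal a * (((\<integral>\<^sup>+x. f x * indicator {0<..u} x \<partial>lborel) + Q u)
      + ((\<integral>\<^sup>+y. g y * f (u - y) \<partial>lborel) + (\<integral>\<^sup>+y. g y * emeasure \<beta> {..u - y} \<partial>lborel)))"
    unfolding g_renewal[OF u] conv by (simp only: distrib_left add_ac)
  then show ?thesis
    unfolding * Q_split[OF u] Q_nonpos[of 0, simplified]
    using a_pos m_pos by (simp add: distrib_left ennreal_mult)
qed

text \<open>Comparing the backward equation at u and at u + s gives g(u + s) + a J(step_mean g)(s) =
  g(u) + a J(g)(s), where J integrates over (u, u + s]. Averaging over an exponential s turns a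
  J(\<phi>) into the mean of \<phi>(u + s), and the mean of g(u + s) cancels.\<close>

lemma g_step:
  assumes u: "0 \<le> u"
  shows "g u = (\<integral>\<^sup>+s. ennreal (exponential_density a s) * step_mean g (u + s) \<partial>lborel)"
proof -
  let ?w = "\<lambda>s. ennreal (exponential_density a s)"
  define I where "I \<phi> u = (\<integral>\<^sup>+x. \<phi> x * indicator {0<..u} x \<partial>lborel)" for \<phi> :: "real \<Rightarrow> ennreal" and u :: real
  define J where "J \<phi> s = (\<integral>\<^sup>+x. \<phi> x * indicator {u<..u + s} x \<partial>lborel)" for \<phi> :: "real \<Rightarrow> ennreal" and s :: real
  have J_measurable [measurable]: "J \<phi> \<in> borel_measurable borel" if [measurable]: "\<phi> \<in> borel_measurable borel" for \<phi>
  proof -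
    have "J \<phi> = (\<lambda>s. \<integral>\<^sup>+x. \<phi> x * (indicator {u<..} x * indicator {0..} (u + s - x)) \<partial>lborel)"
      unfolding J_def by (intro ext nn_integral_cong) (auto simp: indicator_def)
    then show ?thesis by simp
  qed
  have split: "I \<phi> (u + s) = I \<phi> u + J \<phi> s" if "0 \<le> s" "\<phi> \<in> borel_measurable borel" for \<phi> s
    unfolding I_def J_def using that u
    by (subst nn_integral_add[symmetric]) (auto intro!: nn_integral_cong simp: indicator_def)
  have step_le: "step_mean g x \<le> 1" for x
  proof -
    have "step_mean g x \<le> (\<integral>\<^sup>+b. 1 \<partial>\<beta>)"
      unfolding step_mean_def using g_le_1 by (intro nn_integral_mono) (auto simp: indicator_def g_neg)
    then show ?thesis using emeasure_space_1 by simp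
  qed
  \<comment> \<open>The comparison at u and u + s cancels this term, which \<open>ennreal\<close>
    allows only if it is finite.\<close>
  have fin: "I (step_mean g) u \<noteq> \<top>"
  proof -
    have "I (step_mean g) u \<le> (\<integral>\<^sup>+x. indicator {0<..u} x \<partial>lborel)"
      unfolding I_def using step_le by (intro nn_integral_mono) (auto simp: indicator_def)
    also have "\<dots> < \<top>" using u by simp
    finally show ?thesis by simp
  qed
  have J: "g (u + s) + ennreal a * J (step_mean g) s = g u + ennreal a * J g s" if s: "0 \<le> s" for s
  proof -
    have 1: "g (u + s) + ennreal a * (I (step_mean g) u + J (step_mean g) s)
      = ennreal (a * m) + ennreal a * (I g u + J g s)"
      using backward_equation[of "u + s"] u s
      unfolding I_def[symmetric] split[OF s g_measurable] split[OF s step_mean_measurable[OF g_measurable]]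
      by simp
    have 2: "g u + ennreal a * I (step_mean g) u = ennreal (a * m) + ennreal a * I g u"
      using backward_equation[OF u] unfolding I_def .
    have "ennreal a * I (step_mean g) u + (g (u + s) + ennreal a * J (step_mean g) s)
      = g (u + s) + ennreal a * (I (step_mean g) u + J (step_mean g) s)"
      by (simp only: distrib_left add_ac)
    also have "\<dots> = (ennreal (a * m) + ennreal a * I g u) + ennreal a * J g s"
      unfolding 1 by (simp only: distrib_left add.assoc)
    also have "\<dots> = ennreal a * I (step_mean g) u + (g u + ennreal a * J g s)"
      unfolding 2[symmetric] by (simp only: add_ac)
    finally show ?thesis
      using fin by (simp add: ennreal_mult_eq_top_iff)
  qed
  define E where "E = (\<integral>\<^sup>+s. ?w s * g (u + s) \<partial>lborel)"
  have "E \<le> (\<integral>\<^sup>+s. ?w s \<partial>lborel)"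
    unfolding E_def using mult_left_mono[OF g_le_1] by (intro nn_integral_mono) auto
  then have E: "E \<noteq> \<top>"
    unfolding nn_integral_exponential_density[OF a_pos] by (auto simp: top_unique)
  have eq: "(\<integral>\<^sup>+s. ?w s * (g (u + s) + ennreal a * J (step_mean g) s) \<partial>lborel)
     = (\<integral>\<^sup>+s. ?w s * (g u + ennreal a * J g s) \<partial>lborel)"
  proof (intro nn_integral_cong)
    fix s
    show "?w s * (g (u + s) + ennreal a * J (step_mean g) s) = ?w s * (g u + ennreal a * J g s)"
      using J[of s] by (cases "0 \<le> s") (auto simp: exponential_density_def)
  qed
  have prim: "ennreal a * (\<integral>\<^sup>+s. ?w s * J \<phi> s \<partial>lborel) = (\<integral>\<^sup>+s. ?w s * \<phi> (u + s) \<partial>lborel)"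
    if "\<phi> \<in> borel_measurable borel" for \<phi>
    unfolding J_def by (rule nn_integral_exponential_primitive[OF a_pos that])
  have lin: "(\<integral>\<^sup>+s. ?w s * (k s + ennreal a * J \<phi> s) \<partial>lborel)
    = (\<integral>\<^sup>+s. ?w s * k s \<partial>lborel) + (\<integral>\<^sup>+s. ?w s * \<phi> (u + s) \<partial>lborel)"
    if [measurable]: "\<phi> \<in> borel_measurable borel" "k \<in> borel_measurable borel" for \<phi> k
  proof -
    have "(\<integral>\<^sup>+s. ?w s * (k s + ennreal a * J \<phi> s) \<partial>lborel)
      = (\<integral>\<^sup>+s. ?w s * k s + ennreal a * (?w s * J \<phi> s) \<partial>lborel)"
      by (intro nn_integral_cong) (simp add: distrib_left mult_ac)
    also have "\<dots> = (\<integral>\<^sup>+s. ?w s * k s \<partial>lborel) + ennreal a * (\<integral>\<^sup>+s. ?w s * J \<phi> s \<partial>lborel)"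
      by (subst nn_integral_add) (auto simp: nn_integral_cmult)
    finally show ?thesis using prim[OF that(1)] by simp
  qed
  have "E + (\<integral>\<^sup>+s. ?w s * step_mean g (u + s) \<partial>lborel) = E + g u"
    using eq by (simp add: lin E_def nn_integral_multc nn_integral_exponential_density[OF a_pos] add.commute)
  then show ?thesis using E by simp
qed

text \<open>The transition operator of the surplus at claim epochs: first a premium s is earned,
  exponential with rate \<open>a\<close>, then a claim is paid.\<close>

definition step :: "(real \<Rightarrow> ennreal) \<Rightarrow> real \<Rightarrow> ennreal" where
  "step \<phi> u = (\<integral>\<^sup>+s. ennreal (exponential_density a s) * step_mean \<phi> (u + s) \<partial>lborel)"

lemma step_mono: "(\<And>v. \<phi> v \<le> \<psi> v) \<Longrightarrow> step \<phi> u \<le> step \<psi> u"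
  unfolding step_def step_mean_def by (intro nn_integral_mono mult_left_mono add_right_mono) auto

lemma step_add:
  assumes [measurable]: "\<phi> \<in> borel_measurable borel" "\<psi> \<in> borel_measurable borel"
  shows "step (\<lambda>v. \<phi> v + \<psi> v) u
    = step \<phi> u + (\<integral>\<^sup>+s. ennreal (exponential_density a s) * (\<integral>\<^sup>+b. \<psi> (u + s - b) \<partial>\<beta>) \<partial>lborel)"
proof -
  have "step_mean (\<lambda>v. \<phi> v + \<psi> v) v = step_mean \<phi> v + (\<integral>\<^sup>+b. \<psi> (v - b) \<partial>\<beta>)" for v
    unfolding step_mean_def by (subst nn_integral_add[symmetric]) (auto intro!: nn_integral_cong simp: add_ac)
  then show ?thesis
    unfolding step_def by (simp add: distrib_left nn_integral_add)
qed

lemma step_g: "0 \<le> u \<Longrightarrow> step g u = g u"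
  unfolding step_def by (rule g_step[symmetric])

text \<open>The integral is the probability that the surplus rises by at least x in one step. It is
  positive since a claim of size at most n has positive probability for some n, and the premium
  exceeds any level with positive probability. Thus every start in the half-line reaches a given
  level in one step with a probability bounded below.\<close>

lemma upward_jump_pos:
  "(\<integral>\<^sup>+s. ennreal (exponential_density a s) * emeasure \<beta> {..s - x} \<partial>lborel) \<noteq> 0"
proof -
  have "\<exists>n. emeasure \<beta> {..real n} \<noteq> 0"
  proof (rule ccontr)
    assume "\<nexists>n. emeasure \<beta> {..real n} \<noteq> 0"
    then have "emeasure \<beta> (\<Union>n. {..real n}) = 0" by (intro emeasure_UN_eq_0) auto
    moreover have "(\<Union>n. {..real n}) = space \<beta>" by (auto intro: real_arch_simple)
    ultimately show False using emeasure_space_1 by simp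
  qed
  then obtain n where n: "emeasure \<beta> {..real n} \<noteq> 0" ..
  define y where "y = \<bar>x\<bar> + real n"
  have "emeasure \<beta> {..real n} * ennreal (exp (- a * y))
    = (\<integral>\<^sup>+s. emeasure \<beta> {..real n} * (ennreal (exponential_density a s) * indicator {y..} s) \<partial>lborel)"
    using a_pos by (simp add: nn_integral_cmult nn_integral_exponential_tail y_def)
  also have "\<dots> \<le> (\<integral>\<^sup>+s. ennreal (exponential_density a s) * emeasure \<beta> {..s - x} \<partial>lborel)"
  proof (intro nn_integral_mono)
    fix s
    show "emeasure \<beta> {..real n} * (ennreal (exponential_density a s) * indicator {y..} s)
      \<le> ennreal (exponential_density a s) * emeasure \<beta> {..s - x}"
    proof (cases "y \<le> s")
      case True
      then have "emeasure \<beta> {..real n} \<le> emeasure \<beta> {..s - x}"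
        by (intro emeasure_mono) (auto simp: y_def)
      then show ?thesis using True mult_right_mono by (fastforce simp: mult.commute)
    qed simp
  qed
  finally show ?thesis using n by (auto simp: ennreal_eq_0_iff not_le)
qed

text \<open>Two solutions of \<open>\<phi> = step \<phi>\<close> that vanish at infinity agree: their difference at any point is
  an average of differences, a positive fraction of which is taken far out.\<close>

lemma g_le_fixpoint:
  assumes [measurable]: "\<psi> \<in> borel_measurable borel"
    and fixpoint: "\<And>u. 0 \<le> u \<Longrightarrow> step \<psi> u = \<psi> u"
    and le: "\<And>u. \<psi> u \<le> 1"
    and u: "0 \<le> u"
  shows "g u \<le> \<psi> u"
proof -
  \<comment> \<open>\<open>A\<close> consists of the uniform bounds for the excess of g over \<psi>
    on the half-line. Its infimum is again such a bound, and the argument shows that a positive one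
    could be lowered.\<close>
  define A where "A = {c. 0 \<le> c \<and> (\<forall>u\<ge>0. g u \<le> \<psi> u + ennreal c)}"
  have "g v \<le> \<psi> v + 1" for v
    using g_le_1[of v] by (simp add: add_increasing)
  then have "1 \<in> A" by (simp add: A_def)
  then have ne: "A \<noteq> {}" by blast
  have bdd: "bdd_below A" by (auto simp: A_def intro!: bdd_belowI[of _ 0])
  define c where "c = Inf A"
  have c0: "0 \<le> c" unfolding c_def by (rule cInf_greatest[OF ne]) (simp add: A_def)
  have gc: "g u \<le> \<psi> u + ennreal c" if u: "0 \<le> u" for u
  proof (rule ennreal_le_epsilon)
    fix e :: real assume "0 < e"
    then obtain c' where "c' \<in> A" "c' < c + e"
      using cInf_lessD[OF ne, of "c + e"] unfolding c_def by auto
    then have "g u \<le> \<psi> u + ennreal c'" using u by (auto simp: A_def)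
    also have "\<dots> \<le> \<psi> u + ennreal (c + e)" using \<open>c' < c + e\<close> by (intro add_left_mono ennreal_leI) auto
    finally show "g u \<le> \<psi> u + ennreal c + ennreal e"
      using c0 \<open>0 < e\<close> by (simp add: add.assoc)
  qed
  have "c = 0"
  proof (rule ccontr)
    assume "c \<noteq> 0"
    with c0 have c: "0 < c" by simp
    obtain K where K: "0 < K" "\<And>u. g u \<le> ennreal (K * q u)" using g_le_Q by blast
    have "\<forall>\<^sub>F u in at_top. q u < c / (2 * K)" using c K q_tendsto_0 by (intro order_tendstoD) auto
    then obtain x where x: "\<And>u. x \<le> u \<Longrightarrow> q u < c / (2 * K)" unfolding eventually_at_top_linorder by blast
    define p where "p = (\<integral>\<^sup>+s. ennreal (exponential_density a s) * emeasure \<beta> {..s - \<bar>x\<bar>} \<partial>lborel)"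
    have "p \<le> (\<integral>\<^sup>+s. ennreal (exponential_density a s) * 1 \<partial>lborel)"
      unfolding p_def by (intro nn_integral_mono mult_left_mono measure_le_1) auto
    then have "p \<le> 1" using nn_integral_exponential_density[OF a_pos] by simp
    moreover have "p \<noteq> 0" unfolding p_def by (rule upward_jump_pos)
    ultimately obtain p' where p': "p = ennreal p'" "0 < p'" "p' \<le> 1"
      by (cases p) (auto simp: ennreal_eq_0_iff less_le top_unique)
    \<comment> \<open>Beyond \<bar>x\<bar> the function g is at most c / 2, so half of the slack c
      is left over there. \<theta> records this surplus slack, of which one step collects at least c
      / 2 times p'.\<close>
    define \<theta> where "\<theta> v = ennreal (c / 2) * indicator {\<bar>x\<bar>..} v" for v
    have [measurable]: "\<theta> \<in> borel_measurable borel" unfolding \<theta>_def by measurable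
    have far: "g u + ennreal (c / 2 * p') \<le> \<psi> u + ennreal c" if u: "0 \<le> u" for u
    proof -
      have pw: "g v + \<theta> v \<le> (if 0 \<le> v then \<psi> v else 0) + ennreal c" for v
      proof -
        consider "v < 0" | "0 \<le> v" "v < \<bar>x\<bar>" | "\<bar>x\<bar> \<le> v" by linarith
        then show ?thesis
        proof cases
          case 3
          have "g v \<le> ennreal (c / 2)"
          proof (rule order_trans[OF K(2)], rule ennreal_leI)
            have "q v < c / (2 * K)" using 3 by (intro x) auto
            then show "K * q v \<le> c / 2" using K(1) by (simp add: field_simps)
          qed
          then have "g v + \<theta> v \<le> ennreal (c / 2) + ennreal (c / 2)" using 3 by (simp add: \<theta>_def)
          also have "\<dots> = ennreal c" using c by (simp flip: ennreal_plus)
          finally show ?thesis by (rule add_increasing[rotated]) simp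
        qed (use gc in \<open>auto simp: \<theta>_def g_neg\<close>)
      qed
      have "ennreal (c / 2 * p') = (\<integral>\<^sup>+s. ennreal (c / 2) * (ennreal (exponential_density a s) * emeasure \<beta> {..s - \<bar>x\<bar>}) \<partial>lborel)"
      proof -
        have [measurable]: "(\<lambda>y. emeasure \<beta> {..y - \<bar>x\<bar>}) \<in> borel_measurable borel"
          by (rule measurable_compose[OF _ cdf_measurable]) measurable
        show ?thesis
          using c p' ennreal_mult[of "c / 2" p'] by (subst nn_integral_cmult) (auto simp flip: p_def)
      qed
      also have "\<dots> \<le> (\<integral>\<^sup>+s. ennreal (exponential_density a s) * (\<integral>\<^sup>+b. \<theta> (u + s - b) \<partial>\<beta>) \<partial>lborel)"
      proof (intro nn_integral_mono)
        fix s
        have "ennreal (c / 2) * emeasure \<beta> {..s - \<bar>x\<bar>} = (\<integral>\<^sup>+b. ennreal (c / 2) * indicator {..s - \<bar>x\<bar>} b \<partial>\<beta>)"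
          by (simp add: nn_integral_cmult_indicator)
        also have "\<dots> \<le> (\<integral>\<^sup>+b. \<theta> (u + s - b) \<partial>\<beta>)"
          using u by (intro nn_integral_mono) (auto simp: \<theta>_def indicator_def)
        finally show "ennreal (c / 2) * (ennreal (exponential_density a s) * emeasure \<beta> {..s - \<bar>x\<bar>})
          \<le> ennreal (exponential_density a s) * (\<integral>\<^sup>+b. \<theta> (u + s - b) \<partial>\<beta>)"
          by (metis mult.left_commute mult_left_mono zero_le)
      qed
      finally have "g u + ennreal (c / 2 * p') \<le> step (\<lambda>v. g v + \<theta> v) u"
        using u by (simp add: step_add step_g add_left_mono)
      also have "\<dots> \<le> step (\<lambda>v. (if 0 \<le> v then \<psi> v else 0) + ennreal c) u"
        by (intro step_mono pw)
      also have "\<dots> = step (\<lambda>v. if 0 \<le> v then \<psi> v else 0) u + ennreal c"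
        using emeasure_space_1 by (subst step_add) (auto simp: nn_integral_multc nn_integral_exponential_density[OF a_pos])
      also have "\<dots> \<le> step \<psi> u + ennreal c"
        by (intro add_right_mono step_mono) auto
      finally show ?thesis using u by (simp add: fixpoint)
    qed
    have "g u \<le> \<psi> u + ennreal (c - c / 2 * p')" if u: "0 \<le> u" for u
    proof -
      have "ennreal c = ennreal (c - c / 2 * p') + ennreal (c / 2 * p')"
        using c p' mult_mono[of "c/2" c p' 1] by (subst ennreal_plus[symmetric]) auto
      then have "g u + ennreal (c / 2 * p') \<le> \<psi> u + ennreal (c - c / 2 * p') + ennreal (c / 2 * p')"
        using far[OF u] by (simp add: add.assoc)
      then show ?thesis by simp
    qed
    moreover have "0 \<le> c - c / 2 * p'" using c p' mult_mono[of "c/2" c p' 1] by simp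
    ultimately have "c - c / 2 * p' \<in> A" by (auto simp: A_def)
    then have "c \<le> c - c / 2 * p'" using bdd unfolding c_def by (intro cInf_lower)
    then show False using mult_pos_pos[OF c p'(2)] by simp
  qed
  then show ?thesis using gc[OF u] by simp
qed

section \<open>The random walk and first-step analysis of its ruin probability\<close>

definition increment :: "real measure" where
  "increment = distr (\<beta> \<Otimes>\<^sub>M density lborel (exponential_density a)) borel (\<lambda>(b, s). b - s)"

lemma nn_integral_increment:
  assumes [measurable]: "\<phi> \<in> borel_measurable borel"
  shows "(\<integral>\<^sup>+x. \<phi> x \<partial>increment)
    = (\<integral>\<^sup>+s. ennreal (exponential_density a s) * (\<integral>\<^sup>+b. \<phi> (b - s) \<partial>\<beta>) \<partial>lborel)"
proof -
  interpret E: prob_space "density lborel (exponential_density a)"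
    by (rule prob_space_exponential_density[OF a_pos])
  interpret pair_sigma_finite \<beta> "density lborel (exponential_density a)" ..
  have "(\<integral>\<^sup>+x. \<phi> x \<partial>increment)
    = (\<integral>\<^sup>+z. \<phi> (case z of (b, s) \<Rightarrow> b - s) \<partial>(\<beta> \<Otimes>\<^sub>M density lborel (exponential_density a)))"
    unfolding increment_def by (subst nn_integral_distr) auto
  also have "\<dots> = (\<integral>\<^sup>+s. \<integral>\<^sup>+b. \<phi> (b - s) \<partial>\<beta> \<partial>density lborel (exponential_density a))"
    by (subst nn_integral_snd[symmetric]) auto
  also have "\<dots> = (\<integral>\<^sup>+s. ennreal (exponential_density a s) * (\<integral>\<^sup>+b. \<phi> (b - s) \<partial>\<beta>) \<partial>lborel)"
    by (subst nn_integral_density) auto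
  finally show ?thesis .
qed

lemma prob_space_increment: "prob_space increment"
proof -
  interpret E: prob_space "density lborel (exponential_density a)"
    by (rule prob_space_exponential_density[OF a_pos])
  interpret pair_prob_space \<beta> "density lborel (exponential_density a)" ..
  show ?thesis unfolding increment_def by (rule prob_space_distr) measurable
qed

lemma sets_increment [measurable_cong, simp]: "sets increment = sets borel"
  by (simp add: increment_def)

abbreviation walk :: "(nat \<Rightarrow> real) measure" where
  "walk \<equiv> (\<Pi>\<^sub>M i\<in>UNIV. increment)"

text \<open>The indices k < n with inclusive sums run through the first n nonempty partial sums. The
  empty sum is left out, so for negative u the value need not be 1.\<close>

definition ruin_within :: "nat \<Rightarrow> real \<Rightarrow> ennreal" where
  "ruin_within n u = emeasure walk {\<omega> \<in> space walk. \<exists>k<n. u < (\<Sum>i\<le>k. \<omega> i)}"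

definition ruin :: "real \<Rightarrow> ennreal" where
  "ruin u = emeasure walk {\<omega> \<in> space walk. \<exists>k. u < (\<Sum>i\<le>k. \<omega> i)}"

lemma prob_space_walk: "prob_space walk"
  by (intro prob_space_PiM prob_space_increment)

lemma exceed_sets [measurable]:
  "{\<omega> \<in> space walk. \<exists>k<n. u < (\<Sum>i\<le>k. \<omega> i)} \<in> sets walk"
  "{\<omega> \<in> space walk. \<exists>k. u < (\<Sum>i\<le>k. \<omega> i)} \<in> sets walk"
  by measurable

lemma ruin_within_measurable [measurable]: "ruin_within n \<in> borel_measurable borel"
proof -
  interpret W: prob_space walk by (rule prob_space_walk)
  show ?thesis
    unfolding ruin_within_def[abs_def]
    by (rule W.borel_measurable_emeasure_antimono) (auto intro: exceed_sets intro: le_less_trans)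
qed

lemma ruin_measurable [measurable]: "ruin \<in> borel_measurable borel"
proof -
  interpret W: prob_space walk by (rule prob_space_walk)
  show ?thesis
    unfolding ruin_def[abs_def]
    by (rule W.borel_measurable_emeasure_antimono) (auto intro: exceed_sets intro: le_less_trans)
qed

text \<open>Conditioning on the first increment: prepending an independent increment to the walk
  reproduces its law.\<close>

lemma emeasure_walk_iter:
  assumes A: "A \<in> sets walk"
  shows "emeasure walk A = (\<integral>\<^sup>+x. emeasure walk {\<omega> \<in> space walk. case_nat x \<omega> \<in> A} \<partial>increment)"
proof -
  interpret I: prob_space increment by (rule prob_space_increment)
  interpret sequence_space increment ..
  have [measurable]: "A \<in> sets walk" by (rule A)
  have "emeasure walk A = emeasure (distr (increment \<Otimes>\<^sub>M walk) walk (\<lambda>(s, \<omega>). case_nat s \<omega>)) A"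
    by (simp add: PiM_iter)
  also have "\<dots> = emeasure (increment \<Otimes>\<^sub>M walk) ((\<lambda>(s, \<omega>). case_nat s \<omega>) -` A \<inter> space (increment \<Otimes>\<^sub>M walk))"
    by (rule emeasure_distr[OF _ A]) measurable
  also have "\<dots> = (\<integral>\<^sup>+x. emeasure walk (Pair x -` ((\<lambda>(s, \<omega>). case_nat s \<omega>) -` A \<inter> space (increment \<Otimes>\<^sub>M walk))) \<partial>increment)"
    by (rule P.emeasure_pair_measure_alt) measurable
  also have "\<dots> = (\<integral>\<^sup>+x. emeasure walk {\<omega> \<in> space walk. case_nat x \<omega> \<in> A} \<partial>increment)"
    by (intro nn_integral_cong arg_cong[where f = "emeasure walk"]) (auto simp: space_pair_measure)
  finally show ?thesis .
qed

lemma space_walk: "space walk = UNIV"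
  using sets_eq_imp_space_eq[OF sets_increment] by (simp add: space_PiM PiE_UNIV_domain)

lemma partial_sum_case_nat:
  fixes x :: real
  shows "(\<Sum>i\<le>Suc k. case_nat x \<omega> i) = x + (\<Sum>i\<le>k. \<omega> i)"
  by (simp only: sum.atMost_Suc_shift) simp

lemma step_eq_increment:
  assumes [measurable]: "\<phi> \<in> borel_measurable borel"
  shows "step \<phi> u = (\<integral>\<^sup>+x. \<phi> (u - x) + indicator {..<0} (u - x) \<partial>increment)"
  by (subst nn_integral_increment) (auto simp: step_def step_mean_def algebra_simps)

text \<open>If the first increment exceeds u, then k = 0 witnesses ruin and the indicator inside
  \<open>step\<close> accounts for it; otherwise the shifted walk must exceed u - x within n steps.
  The truncation to v \<ge> 0 keeps ruin in the first step from being counted twice.\<close>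

lemma ruin_within_Suc:
  assumes u: "0 \<le> u"
  shows "ruin_within (Suc n) u = step (\<lambda>v. if 0 \<le> v then ruin_within n v else 0) u"
proof -
  have "emeasure walk {\<omega> \<in> space walk. case_nat x \<omega> \<in> {\<omega> \<in> space walk. \<exists>k<Suc n. u < (\<Sum>i\<le>k. \<omega> i)}}
    = (if 0 \<le> u - x then ruin_within n (u - x) else 0) + indicator {..<0} (u - x)" for x
  proof (cases "u < x")
    case True
    then have "{\<omega> \<in> space walk. case_nat x \<omega> \<in> {\<omega> \<in> space walk. \<exists>k<Suc n. u < (\<Sum>i\<le>k. \<omega> i)}} = space walk"
      by (auto simp: space_walk intro!: exI[of _ 0])
    then show ?thesis using True prob_space.emeasure_space_1[OF prob_space_walk] by simp
  next
    case False
    have "(\<exists>k<Suc n. u < (\<Sum>i\<le>k. case_nat x \<omega> i)) \<longleftrightarrow> (\<exists>k<n. u - x < (\<Sum>i\<le>k. \<omega> i))" for \<omega>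
      unfolding Ex_less_Suc2 partial_sum_case_nat using False by auto
    then show ?thesis using False by (simp add: space_walk ruin_within_def)
  qed
  then show ?thesis
    unfolding ruin_within_def[of "Suc n"]
    by (subst emeasure_walk_iter) (auto simp: step_eq_increment)
qed

lemma ruin_step:
  assumes u: "0 \<le> u"
  shows "ruin u = step (\<lambda>v. if 0 \<le> v then ruin v else 0) u"
proof -
  have "emeasure walk {\<omega> \<in> space walk. case_nat x \<omega> \<in> {\<omega> \<in> space walk. \<exists>k. u < (\<Sum>i\<le>k. \<omega> i)}}
    = (if 0 \<le> u - x then ruin (u - x) else 0) + indicator {..<0} (u - x)" for x
  proof (cases "u < x")
    case True
    then have "{\<omega> \<in> space walk. case_nat x \<omega> \<in> {\<omega> \<in> space walk. \<exists>k. u < (\<Sum>i\<le>k. \<omega> i)}} = space walk"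
      by (auto simp: space_walk intro!: exI[of _ 0])
    then show ?thesis using True prob_space.emeasure_space_1[OF prob_space_walk] by simp
  next
    case False
    have "(\<exists>k. u < (\<Sum>i\<le>k. case_nat x \<omega> i)) \<longleftrightarrow> (\<exists>k. u - x < (\<Sum>i\<le>k. \<omega> i))" for \<omega>
    proof -
      have "(\<exists>k. P k) \<longleftrightarrow> P 0 \<or> (\<exists>k. P (Suc k))" for P :: "nat \<Rightarrow> bool" by (metis not0_implies_Suc)
      from this[of "\<lambda>k. u < (\<Sum>i\<le>k. case_nat x \<omega> i)"] show ?thesis
        unfolding partial_sum_case_nat using False by (simp add: diff_less_eq add.commute)
    qed
    then show ?thesis using False by (simp add: space_walk ruin_def)
  qed
  then show ?thesis
    unfolding ruin_def[of u]
    by (subst emeasure_walk_iter) (auto simp: step_eq_increment)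
qed

lemma ruin_SUP: "ruin u = (SUP n. ruin_within n u)"
proof -
  have "(SUP n. ruin_within n u) = emeasure walk (\<Union>n. {\<omega> \<in> space walk. \<exists>k<n. u < (\<Sum>i\<le>k. \<omega> i)})"
    unfolding ruin_within_def
    by (rule SUP_emeasure_incseq) (auto simp: incseq_def intro: exceed_sets less_le_trans)
  also have "(\<Union>n. {\<omega> \<in> space walk. \<exists>k<n. u < (\<Sum>i\<le>k. \<omega> i)}) = {\<omega> \<in> space walk. \<exists>k. u < (\<Sum>i\<le>k. \<omega> i)}"
    by auto
  finally show ?thesis by (simp add: ruin_def)
qed

lemma ruin_within_le_g: "0 \<le> u \<Longrightarrow> ruin_within n u \<le> g u"
proof (induction n arbitrary: u)
  case 0
  then show ?case by (simp add: ruin_within_def)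
next
  case (Suc n)
  have "ruin_within (Suc n) u \<le> step g u"
    unfolding ruin_within_Suc[OF Suc.prems] by (intro step_mono) (auto intro: Suc.IH)
  then show ?case using Suc.prems by (simp add: step_g)
qed

lemma ruin_eq_g:
  assumes u: "0 \<le> u"
  shows "ruin u = g u"
proof (rule antisym)
  show "ruin u \<le> g u"
    unfolding ruin_SUP using u by (intro SUP_least ruin_within_le_g)
  have "ruin v \<le> 1" for v
    unfolding ruin_def by (rule prob_space.measure_le_1[OF prob_space_walk])
  then have "g u \<le> (if 0 \<le> u then ruin u else 0)"
    using u by (intro g_le_fixpoint) (auto simp: ruin_step[symmetric])
  then show "g u \<le> ruin u" using u by simp
qed

end

subsection \<open>Poisson epochs and sample paths\<close>

lemma poisson_epochs_pathD:
  assumes "poisson_epochs M rate T" "w \<in> space M"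
  shows "T 0 w = 0" "strict_mono (\<lambda>n. T n w)"
  using assms by (auto simp: poisson_epochs_def)

lemma poisson_epochs_nonneg:
  assumes "poisson_epochs M rate T" "w \<in> space M"
  shows "0 \<le> T n w"
  using poisson_epochs_pathD[OF assms] strict_mono_less_eq[of "\<lambda>n. T n w" 0 n] by simp

lemma poisson_epochs_eq_sum:
  assumes "poisson_epochs M rate T" "w \<in> space M"
  shows "T n w = (\<Sum>i<n. T (Suc i) w - T i w)"
  using poisson_epochs_pathD[OF assms] sum_lessThan_telescope[of "\<lambda>n. T n w" n] by simp

lemma poisson_epochs_increment_measurable:
  assumes "poisson_epochs M rate T"
  shows "(\<lambda>w. T (Suc n) w - T n w) \<in> borel_measurable M"
  using assms by (auto simp: poisson_epochs_def distributed_def)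

lemma poisson_epochs_measurable:
  assumes "poisson_epochs M rate T"
  shows "T n \<in> borel_measurable M"
proof -
  note [measurable] = poisson_epochs_increment_measurable[OF assms]
  have "(\<lambda>w. \<Sum>i<n. T (Suc i) w - T i w) \<in> borel_measurable M" by measurable
  then show ?thesis
    by (rule measurable_cong[THEN iffD1, rotated]) (simp add: poisson_epochs_eq_sum[OF assms, symmetric])
qed

context prob_space
begin

text \<open>If all epochs are at most x, so are the first n + 1 gaps; by independence this has
  probability at most (1 - exp(- x rate))^(n + 1) for every n.\<close>

lemma prob_epochs_bounded_eq_0:
  assumes T: "poisson_epochs M rate T" and rate: "0 < rate" and x: "0 \<le> x"
  shows "prob {w \<in> space M. \<forall>n. T n w \<le> x} = 0"
proof -
  note [measurable] = poisson_epochs_measurable[OF T]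
  let ?D = "\<lambda>n w. T (Suc n) w - T n w"
  have ind: "indep_vars (\<lambda>_. borel) ?D UNIV"
    and dist: "\<And>n. distributed M lborel (?D n) (exponential_density rate)"
    using T by (auto simp: poisson_epochs_def)
  have le: "prob {w \<in> space M. \<forall>n. T n w \<le> x} \<le> (1 - exp (- x * rate)) ^ Suc n" for n
  proof -
    have "prob {w \<in> space M. \<forall>n. T n w \<le> x} \<le> prob (\<Inter>i\<in>{..n}. ?D i -` {..x} \<inter> space M)"
    proof (intro finite_measure_mono subsetI)
      fix w assume w: "w \<in> {w \<in> space M. \<forall>n. T n w \<le> x}"
      then have "T (Suc i) w - T i w \<le> x" for i
        using poisson_epochs_nonneg[OF T, of w i] by (simp add: add_increasing2 diff_le_eq)
      then show "w \<in> (\<Inter>i\<in>{..n}. ?D i -` {..x} \<inter> space M)"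
        using w by simp
    qed (auto intro!: sets.finite_INT)
    also have "\<dots> = (\<Prod>i\<in>{..n}. prob (?D i -` {..x} \<inter> space M))"
      by (rule indep_varsD[OF ind]) auto
    also have "\<dots> = (\<Prod>i\<in>{..n}. 1 - exp (- x * rate))"
      using exponential_distributedD_le[OF dist x rate]
      by (intro prod.cong refl) (simp add: vimage_def Int_def conj_commute)
    finally show ?thesis by simp
  qed
  have "(\<lambda>n. (1 - exp (- x * rate)) ^ Suc n) \<longlonglongrightarrow> 0"
  proof (intro LIMSEQ_Suc LIMSEQ_power_zero)
    have "exp (- x * rate) \<le> 1" using x rate by simp
    then show "norm (1 - exp (- x * rate)) < 1" using exp_gt_zero[of "- x * rate"] by simp
  qed
  then have "prob {w \<in> space M. \<forall>n. T n w \<le> x} \<le> 0"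
    by (rule LIMSEQ_le_const) (use le in auto)
  then show ?thesis by (simp add: measure_le_0_iff)
qed

lemma AE_epochs_unbounded:
  assumes T: "poisson_epochs M rate T" and rate: "0 < rate"
  shows "AE w in M. \<forall>x. \<exists>n. x < T n w"
proof -
  note [measurable] = poisson_epochs_measurable[OF T]
  have "AE w in M. \<exists>n. real j < T n w" for j
  proof (rule AE_I[of _ _ "{w \<in> space M. \<forall>n. T n w \<le> real j}"])
    show "emeasure M {w \<in> space M. \<forall>n. T n w \<le> real j} = 0"
      using prob_epochs_bounded_eq_0[OF T rate, of "real j"] by (simp add: emeasure_eq_measure)
  qed (auto simp: not_less)
  then have "AE w in M. \<forall>j. \<exists>n. real j < T n w" by (simp add: AE_all_countable)
  then show ?thesis
    by eventually_elim (meson le_less_trans real_arch_simple)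
qed

text \<open>Memorylessness, conditionally on the n-th epoch. That epoch is the sum of the earlier
  gaps and so independent of the next one; given its value x < t, the gap tails at t + L - x and t -
  x differ by the factor exp(- rate L).\<close>

lemma prob_epoch_gap:
  assumes T: "poisson_epochs M rate T" and rate: "0 < rate" and L: "0 \<le> L"
  shows "emeasure M {w \<in> space M. T n w < t \<and> t + L < T (Suc n) w}
    = ennreal (exp (- rate * L)) * emeasure M {w \<in> space M. T n w < t \<and> t < T (Suc n) w}"
proof -
  note [measurable] = poisson_epochs_measurable[OF T]
  let ?D = "\<lambda>n w. T (Suc n) w - T n w"
  have ind: "indep_vars (\<lambda>_. borel) ?D UNIV"
    and dist: "distributed M lborel (?D n) (exponential_density rate)"
    using T by (auto simp: poisson_epochs_def)
  have "indep_var borel (?D n) borel (\<lambda>w. \<Sum>i<n. ?D i w)"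
    by (rule indep_vars_sum) (auto intro: indep_vars_subset[OF ind])
  then have prod: "distr M borel (?D n) \<Otimes>\<^sub>M distr M borel (\<lambda>w. \<Sum>i<n. ?D i w)
    = distr M (borel \<Otimes>\<^sub>M borel) (\<lambda>w. (?D n w, \<Sum>i<n. ?D i w))"
    by (simp add: indep_var_distribution_eq)
  define \<mu> where "\<mu> = distr M borel (\<lambda>w. \<Sum>i<n. ?D i w)"
  interpret D: prob_space "distr M borel (?D n)" by (rule prob_space_distr) measurable
  interpret S: prob_space \<mu> unfolding \<mu>_def by (rule prob_space_distr) measurable
  interpret P: pair_sigma_finite "distr M borel (?D n)" \<mu> ..
  have [measurable_cong]: "sets \<mu> = sets borel" by (simp add: \<mu>_def)
  have gap: "emeasure M {w \<in> space M. T n w < t \<and> t + l < T (Suc n) w}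
    = (\<integral>\<^sup>+x. indicator {..<t} x * ennreal (exp (- (t + l - x) * rate)) \<partial>\<mu>)" if l: "0 \<le> l" for l
  proof -
    let ?A = "{z \<in> space (borel \<Otimes>\<^sub>M borel). snd z < t \<and> t + l < fst z + snd z} :: (real \<times> real) set"
    have [measurable]: "?A \<in> sets (borel \<Otimes>\<^sub>M borel)" by measurable
    have "emeasure M {w \<in> space M. T n w < t \<and> t + l < T (Suc n) w}
      = emeasure M ((\<lambda>w. (?D n w, \<Sum>i<n. ?D i w)) -` ?A \<inter> space M)"
    proof (rule arg_cong[where f = "emeasure M"], rule set_eqI)
      fix w
      show "w \<in> {w \<in> space M. T n w < t \<and> t + l < T (Suc n) w}
        \<longleftrightarrow> w \<in> (\<lambda>w. (?D n w, \<Sum>i<n. ?D i w)) -` ?A \<inter> space M"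
      proof (cases "w \<in> space M")
        case True
        then show ?thesis unfolding poisson_epochs_eq_sum[OF T True, of n, symmetric]
          by (simp add: space_pair_measure poisson_epochs_eq_sum[OF T True, of n, symmetric])
      qed simp
    qed
    also have "\<dots> = emeasure (distr M borel (?D n) \<Otimes>\<^sub>M \<mu>) ?A"
      unfolding \<mu>_def prod by (subst emeasure_distr) auto
    also have "\<dots> = (\<integral>\<^sup>+x. emeasure (distr M borel (?D n)) ((\<lambda>y. (y, x)) -` ?A) \<partial>\<mu>)"
      by (rule P.emeasure_pair_measure_alt2) measurable
    also have "\<dots> = (\<integral>\<^sup>+x. indicator {..<t} x * ennreal (exp (- (t + l - x) * rate)) \<partial>\<mu>)"
    proof (intro nn_integral_cong)
      fix x
      show "emeasure (distr M borel (?D n)) ((\<lambda>y. (y, x)) -` ?A)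
        = indicator {..<t} x * ennreal (exp (- (t + l - x) * rate))"
      proof (cases "x < t")
        case True
        have eq: "(\<lambda>y. (y, x)) -` ?A = {t + l - x<..}"
          using True by (auto simp: space_pair_measure)
        have "emeasure (distr M borel (?D n)) ((\<lambda>y. (y, x)) -` ?A) = emeasure M (?D n -` {t + l - x<..} \<inter> space M)"
          unfolding eq by (rule emeasure_distr) measurable
        also have "\<dots> = emeasure M {w \<in> space M. t + l - x < ?D n w}"
          by (simp only: vimage_def Int_def greaterThan_iff mem_Collect_eq conj_commute)
        also have "\<dots> = ennreal (exp (- (t + l - x) * rate))"
        proof -
          have "0 \<le> t + l - x" using True l by simp
          from exponential_distributedD_gt[OF dist this rate] show ?thesis
            unfolding emeasure_eq_measure by (rule arg_cong)
        qed
        finally show ?thesis using True by simp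
      qed (simp add: vimage_def)
    qed
    finally show ?thesis .
  qed
  have "emeasure M {w \<in> space M. T n w < t \<and> t + L < T (Suc n) w}
    = (\<integral>\<^sup>+x. ennreal (exp (- rate * L)) * (indicator {..<t} x * ennreal (exp (- (t + 0 - x) * rate))) \<partial>\<mu>)"
    unfolding gap[OF L]
  proof (intro nn_integral_cong)
    fix x
    have "exp (- (t + L - x) * rate) = exp (- rate * L) * exp (- (t + 0 - x) * rate)"
      unfolding exp_add[symmetric] by (simp add: algebra_simps)
    then have "ennreal (exp (- (t + L - x) * rate)) = ennreal (exp (- rate * L)) * ennreal (exp (- (t + 0 - x) * rate))"
      by (simp only: ennreal_mult exp_ge_zero)
    then show "indicator {..<t} x * ennreal (exp (- (t + L - x) * rate))
      = ennreal (exp (- rate * L)) * (indicator {..<t} x * ennreal (exp (- (t + 0 - x) * rate)))"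
      by (simp only: mult.left_commute)
  qed
  also have "\<dots> = ennreal (exp (- rate * L)) * emeasure M {w \<in> space M. T n w < t \<and> t < T (Suc n) w}"
    using gap[of 0] by (simp add: nn_integral_cmult)
  finally show ?thesis .
qed

text \<open>Decompose by the index n of the last epoch before t. The events that t lies strictly
  between epochs n and n + 1 are disjoint, so the common factor exp(- rate L) multiplies a total of
  at most 1.\<close>

lemma prob_no_epoch_le:
  assumes T: "poisson_epochs M rate T" and rate: "0 < rate" and L: "0 \<le> L" and t: "0 \<le> t"
  shows "emeasure M {w \<in> space M. \<forall>n. T n w \<notin> {t..t + L}} \<le> ennreal (exp (- rate * L))"
proof -
  note [measurable] = poisson_epochs_measurable[OF T]
  have "emeasure M {w \<in> space M. \<forall>n. T n w \<notin> {t..t + L}}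
    \<le> emeasure M (\<Union>n. {w \<in> space M. T n w < t \<and> t + L < T (Suc n) w})"
  proof (rule emeasure_mono_AE)
    show "AE w in M. w \<in> {w \<in> space M. \<forall>n. T n w \<notin> {t..t + L}} \<longrightarrow>
        w \<in> (\<Union>n. {w \<in> space M. T n w < t \<and> t + L < T (Suc n) w})"
      using AE_epochs_unbounded[OF T rate] AE_space
    proof eventually_elim
      case (elim w)
      show ?case
      proof
        assume w: "w \<in> {w \<in> space M. \<forall>n. T n w \<notin> {t..t + L}}"
        \<comment> \<open>The first epoch beyond the window. It is not epoch 0, which sits at time
          0, so it has a predecessor; that one is not in the window and hence lies before t.\<close>
        define k where "k = (LEAST n. t + L < T n w)"
        have k: "t + L < T k w" unfolding k_def by (rule LeastI_ex) (use elim(1) in blast)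
        have "k \<noteq> 0" using k poisson_epochs_pathD(1)[OF T elim(2)] t L by (intro notI) simp
        then obtain n where n: "k = Suc n" by (cases k) auto
        have "\<not> t + L < T n w" using not_less_Least[of n "\<lambda>n. t + L < T n w"] n by (simp add: k_def)
        then have "T n w < t" using w by (auto simp: not_le not_less)
        then show "w \<in> (\<Union>n. {w \<in> space M. T n w < t \<and> t + L < T (Suc n) w})"
          using k n elim(2) by auto
      qed
    qed
  qed measurable
  also have "\<dots> \<le> (\<Sum>n. emeasure M {w \<in> space M. T n w < t \<and> t + L < T (Suc n) w})"
    by (rule emeasure_subadditive_countably) auto
  also have "\<dots> = ennreal (exp (- rate * L)) * (\<Sum>n. emeasure M {w \<in> space M. T n w < t \<and> t < T (Suc n) w})"
    by (simp add: prob_epoch_gap[OF T rate L])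
  also have "(\<Sum>n. emeasure M {w \<in> space M. T n w < t \<and> t < T (Suc n) w})
    = emeasure M (\<Union>n. {w \<in> space M. T n w < t \<and> t < T (Suc n) w})"
  proof (rule suminf_emeasure)
    have "m = n" if "w \<in> space M" "T m w < t" "t < T (Suc m) w" "T n w < t" "t < T (Suc n) w" for m n w
    proof (rule ccontr)
      have less: "i < Suc j" if "T i w < t" "t < T (Suc j) w" for i j
        using less_trans[OF that] strict_mono_less[OF poisson_epochs_pathD(2)[OF T \<open>w \<in> space M\<close>]] by blast
      assume "m \<noteq> n"
      then show False using less[of m n] less[of n m] that by auto
    qed
    then show "disjoint_family (\<lambda>n. {w \<in> space M. T n w < t \<and> t < T (Suc n) w})"
      by (auto simp: disjoint_family_on_def)
  qed auto
  also have "ennreal (exp (- rate * L)) * \<dots> \<le> ennreal (exp (- rate * L)) * 1"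
    by (intro mult_left_mono measure_le_1) auto
  finally show ?thesis by simp
qed

end

text \<open>With j the first index such that \<open>t < T j\<close>, the counted indices are 1, ...,
  j - 1, as index 0 is no arrival; and k \<le> j - 1 means k < j. Divergence of the epochs
  guarantees that j exists and the counted set is finite.\<close>

lemma le_card_epochs_iff:
  fixes T :: "nat \<Rightarrow> real"
  assumes T: "strict_mono T" "T 0 = 0" "\<And>x. \<exists>n. x < T n" and t: "0 \<le> t"
  shows "k \<le> card {n. 1 \<le> n \<and> T n \<le> t} \<longleftrightarrow> T k \<le> t"
proof -
  define j where "j = (LEAST n. t < T n)"
  have j: "t < T j" unfolding j_def by (rule LeastI_ex) (rule T)
  have "j \<noteq> 0" using j T(2) t by (intro notI) simp
  have iff: "T n \<le> t \<longleftrightarrow> n < j" for n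
  proof
    assume "T n \<le> t"
    with j have "T n < T j" by simp
    then show "n < j" unfolding strict_mono_less[OF T(1)] .
  next
    assume "n < j"
    then show "T n \<le> t" using not_less_Least[of n "\<lambda>n. t < T n"] by (simp add: j_def not_less)
  qed
  have "{n. 1 \<le> n \<and> T n \<le> t} = {1..<j}" unfolding iff by auto
  then have "card {n. 1 \<le> n \<and> T n \<le> t} = j - 1" by simp
  then show ?thesis using \<open>j \<noteq> 0\<close> unfolding iff by linarith
qed

section \<open>Deterministic sample paths: the surplus process against its embedded walk\<close>

locale claim_path =
  fixes T :: "nat \<Rightarrow> real" and N :: "real \<Rightarrow> nat" and C :: "nat \<Rightarrow> real" and r :: real
  assumes T0: "T 0 = 0"
    and count: "\<And>k t. 0 \<le> t \<Longrightarrow> k \<le> N t \<longleftrightarrow> T k \<le> t"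
    and claims: "\<And>i. 0 \<le> C i"
    and r_pos: "0 < r"
begin

definition Y :: "real \<Rightarrow> real" where "Y t = (\<Sum>i<N t. C i) - r * t"

lemma sum_increments: "(\<Sum>i<k. C i - r * (T (Suc i) - T i)) = (\<Sum>i<k. C i) - r * T k"
proof -
  have "(\<Sum>i<k. C i - r * (T (Suc i) - T i)) = (\<Sum>i<k. C i) - r * (\<Sum>i<k. T (Suc i) - T i)"
    by (subst sum_subtractf) (simp only: sum_distrib_left)
  then show ?thesis using T0 by (simp only: sum_lessThan_telescope) simp
qed

lemma Y_decrease: "0 \<le> s \<Longrightarrow> s \<le> t \<Longrightarrow> Y s - r * (t - s) \<le> Y t"
proof -
  assume "0 \<le> s" "s \<le> t"
  then have "N s \<le> N t" using count[of s "N s"] count[of t "N s"] by auto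
  then have "(\<Sum>i<N s. C i) \<le> (\<Sum>i<N t. C i)" by (intro sum_mono2) (auto simp: claims)
  then show ?thesis unfolding Y_def right_diff_distrib by linarith
qed

text \<open>After the last arrival before t only premium has come in, so at \<open>T (N t)\<close>
  the process was at least as high as at t, and there it equals a partial sum of the walk. As u
  \<ge> 0, at least one arrival has occurred.\<close>

lemma exceed_imp_walk_exceed:
  assumes t: "0 \<le> t" and u: "0 \<le> u" "u < Y t"
  shows "\<exists>k. u < (\<Sum>i\<le>k. C i - r * (T (Suc i) - T i))"
proof -
  have "r * T (N t) \<le> r * t" using count[OF t, of "N t"] r_pos by simp
  then have le: "u < (\<Sum>i<N t. C i - r * (T (Suc i) - T i))"
    using u unfolding sum_increments Y_def by linarith
  then have "N t \<noteq> 0" using u by (intro notI) simp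
  then obtain k where "N t = Suc k" by (cases "N t") auto
  then show ?thesis using le by (auto simp: lessThan_Suc_atMost)
qed

text \<open>The partial sum is attained at an arrival epoch, which may be irrational. A rational
  time so shortly afterwards that the premium earned is less than the excess over u still
  works.\<close>

lemma walk_exceed_imp_exceed:
  assumes T: "0 \<le> T (Suc k)" and u: "u < (\<Sum>i\<le>k. C i - r * (T (Suc i) - T i))"
  shows "\<exists>t\<in>\<rat>. 0 \<le> t \<and> u < Y t"
proof -
  let ?S = "(\<Sum>i\<le>k. C i - r * (T (Suc i) - T i))"
  have S: "?S = (\<Sum>i<Suc k. C i) - r * T (Suc k)"
    using sum_increments[of "Suc k"] by (simp only: lessThan_Suc_atMost)
  obtain t where t: "t \<in> \<rat>" "T (Suc k) < t" "t < T (Suc k) + (?S - u) / r"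
    using Rats_dense_in_real[of "T (Suc k)" "T (Suc k) + (?S - u) / r"] u r_pos by auto
  have "0 \<le> t" using T t by simp
  moreover have "Suc k \<le> N t" using count[OF \<open>0 \<le> t\<close>, of "Suc k"] t by simp
  then have "(\<Sum>i<Suc k. C i) \<le> (\<Sum>i<N t. C i)" by (intro sum_mono2) (auto simp: claims)
  moreover have "r * (t - T (Suc k)) < ?S - u" using t(3) r_pos by (simp add: field_simps)
  ultimately have "u < Y t" unfolding Y_def using S unfolding right_diff_distrib by linarith
  then show ?thesis using t \<open>0 \<le> t\<close> by blast
qed

end

subsection \<open>Independence of claims and arrival epochs\<close>

lemma exponential_distributed_scale:
  assumes "prob_space M" and D: "distributed M lborel X (exponential_density l)" and l: "0 < l" and c: "0 < c"
  shows "distributed M lborel (\<lambda>w. c * X w) (exponential_density (l / c))"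
proof -
  interpret prob_space M by fact
  have X: "X \<in> borel_measurable M" "\<And>x. 0 \<le> x \<Longrightarrow> \<P>(w in M. X w \<le> x) = 1 - exp (- x * l)"
    using exponential_distributed_iff[OF l] D by auto
  have "\<P>(w in M. c * X w \<le> x) = 1 - exp (- x * (l / c))" if "0 \<le> x" for x
  proof -
    have "\<P>(w in M. c * X w \<le> x) = \<P>(w in M. X w \<le> x / c)"
      using c by (simp add: pos_le_divide_eq mult.commute)
    also have "\<dots> = 1 - exp (- x * (l / c))" using X(2)[of "x / c"] that c by simp
    finally show ?thesis .
  qed
  then show ?thesis using X(1) l c by (subst exponential_distributed_iff) auto
qed

context prob_space
begin

lemma indep_vars_prob_Ball:
  assumes X: "indep_vars M' X I" and J: "finite J" "J \<subseteq> I" and E: "\<And>i. i \<in> J \<Longrightarrow> E i \<in> sets (M' i)"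
  shows "prob {w \<in> space M. \<forall>i\<in>J. X i w \<in> E i} = (\<Prod>i\<in>J. prob (X i -` E i \<inter> space M))"
proof (cases "J = {}")
  case False
  have "{w \<in> space M. \<forall>i\<in>J. X i w \<in> E i} = (\<Inter>i\<in>J. X i -` E i \<inter> space M)"
    using False by auto
  then show ?thesis using indep_varsD[OF X False J E] by simp
qed (simp add: prob_space)

lemma prob_indep_elems:
  assumes "indep_elems M S X T Z" and "A \<in> sets S" "D \<in> sets T"
  shows "prob ((X -` A \<inter> space M) \<inter> (Z -` D \<inter> space M)) = prob (X -` A \<inter> space M) * prob (Z -` D \<inter> space M)"
proof (rule indep_setD)
  show "indep_set {X -` A \<inter> space M | A. A \<in> sets S} {Z -` A \<inter> space M | A. A \<in> sets T}"
    using assms(1) by (simp add: indep_elems_def)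
qed (use assms(2,3) in blast)+

text \<open>The arrival epochs are recovered almost surely from the counting process at rational times.\<close>

lemma prob_claims_epochs:
  fixes C :: "nat \<Rightarrow> 'a \<Rightarrow> real"
  assumes T: "poisson_epochs M rate T" and rate: "0 < rate"
    and N: "\<And>t w. 0 \<le> t \<Longrightarrow> w \<in> space M \<Longrightarrow> N t w = card {n. 1 \<le> n \<and> T n w \<le> t}"
    and ind: "indep_elems M (\<Pi>\<^sub>M i\<in>UNIV. borel) (\<lambda>w i. C i w)
      (\<Pi>\<^sub>M t\<in>{0::real..}. count_space UNIV) (\<lambda>w. \<lambda>t\<in>{0..}. N t w)"
    and A [measurable]: "A \<in> sets (\<Pi>\<^sub>M i\<in>UNIV. borel)" and D [measurable]: "D \<in> sets (\<Pi>\<^sub>M i\<in>UNIV. borel)"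
  shows "prob {w \<in> space M. (\<lambda>i. C i w) \<in> A \<and> (\<lambda>n. T n w) \<in> D}
    = prob {w \<in> space M. (\<lambda>i. C i w) \<in> A} * prob {w \<in> space M. (\<lambda>n. T n w) \<in> D}"
proof -
  note T_meas [measurable] = poisson_epochs_measurable[OF T]
  define R :: "real set" where "R = \<rat> \<inter> {0..}"
  have R: "countable R" by (simp add: R_def countable_rat)
  \<comment> \<open>A generalised inverse of the counting path: epoch n is the infimum of the times
    t with N t \<ge> n. Restricting to rational times makes the infimum countable and hence
    measurable; times that fail the condition contribute infinity, so the index set is the same for
    all paths.\<close>
  define \<Theta> :: "(real \<Rightarrow> nat) \<Rightarrow> nat \<Rightarrow> real"
    where "\<Theta> x n = real_of_ereal (INF t\<in>R. if n \<le> x t then ereal t else \<infinity>)" for x n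
  have C_meas [measurable]: "(\<lambda>w i. C i w) \<in> measurable M (\<Pi>\<^sub>M i\<in>UNIV. borel)"
    and N_meas [measurable]: "(\<lambda>w. \<lambda>t\<in>{0..}. N t w) \<in> measurable M (\<Pi>\<^sub>M t\<in>{0::real..}. count_space UNIV)"
    using ind by (auto simp: indep_elems_def)
  have \<Theta>_meas [measurable]: "\<Theta> \<in> measurable (\<Pi>\<^sub>M t\<in>{0..}. count_space UNIV) (\<Pi>\<^sub>M i\<in>UNIV. borel)"
  proof -
    have "(\<lambda>x. \<Theta> x n) \<in> borel_measurable (\<Pi>\<^sub>M t\<in>{0..}. count_space UNIV)" for n
    proof -
      have [measurable]: "(\<lambda>x. x t) \<in> measurable (\<Pi>\<^sub>M t\<in>{0::real..}. count_space (UNIV :: nat set)) (count_space UNIV)"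
        if "t \<in> R" for t
        using that by (intro measurable_component_singleton) (auto simp: R_def)
      show ?thesis
        unfolding \<Theta>_def
        by (intro borel_measurable_real_of_ereal borel_measurable_INF[OF R]) measurable
    qed
    then show ?thesis by (intro measurable_PiM_single') (auto simp: space_PiM)
  qed
  have eq: "AE w in M. (\<lambda>n. T n w) = \<Theta> (\<lambda>t\<in>{0..}. N t w)"
    using AE_epochs_unbounded[OF T rate] AE_space
  proof eventually_elim
    case (elim w)
    have N_iff: "n \<le> N t w \<longleftrightarrow> T n w \<le> t" if "0 \<le> t" for n t
      unfolding N[OF that elim(2)]
      using poisson_epochs_pathD[OF T elim(2)] elim(1) that by (intro le_card_epochs_iff) auto
    have "(INF t\<in>R. if n \<le> (\<lambda>t\<in>{0..}. N t w) t then ereal t else \<infinity>) = ereal (T n w)" for n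
    proof (rule antisym)
      show "ereal (T n w) \<le> (INF t\<in>R. if n \<le> (\<lambda>t\<in>{0..}. N t w) t then ereal t else \<infinity>)"
        by (intro INF_greatest) (auto simp: R_def N_iff)
      show "(INF t\<in>R. if n \<le> (\<lambda>t\<in>{0..}. N t w) t then ereal t else \<infinity>) \<le> ereal (T n w)"
      proof (rule ereal_le_epsilon2)
        fix e :: real assume "0 < e"
        then obtain t where t: "t \<in> \<rat>" "T n w < t" "t < T n w + e"
          using Rats_dense_in_real[of "T n w" "T n w + e"] by auto
        then have "t \<in> R" using poisson_epochs_nonneg[OF T elim(2), of n] by (simp add: R_def)
        then have "(INF t\<in>R. if n \<le> (\<lambda>t\<in>{0..}. N t w) t then ereal t else \<infinity>)
          \<le> (if n \<le> (\<lambda>t\<in>{0..}. N t w) t then ereal t else \<infinity>)"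
          by (rule INF_lower)
        also have "\<dots> = ereal t" using t \<open>t \<in> R\<close> by (simp add: R_def N_iff)
        also have "\<dots> \<le> ereal (T n w) + ereal e" using t by simp
        finally show "(INF t\<in>R. if n \<le> (\<lambda>t\<in>{0..}. N t w) t then ereal t else \<infinity>) \<le> ereal (T n w) + ereal e" .
      qed
    qed
    then show ?case by (simp add: \<Theta>_def fun_eq_iff)
  qed
  let ?D = "\<Theta> -` D \<inter> space (\<Pi>\<^sub>M t\<in>{0..}. count_space UNIV)"
  have D': "?D \<in> sets (\<Pi>\<^sub>M t\<in>{0..}. count_space UNIV)" by measurable
  have space_N: "(\<lambda>t\<in>{0..}. N t w) \<in> space (\<Pi>\<^sub>M t\<in>{0..}. count_space UNIV)" if "w \<in> space M" for w
    using measurable_space[OF N_meas that] .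
  have T_seq [measurable]: "(\<lambda>w n. T n w) \<in> measurable M (\<Pi>\<^sub>M i\<in>UNIV. borel)"
    by (intro measurable_PiM_single') (auto simp: space_PiM)
  let ?CA = "(\<lambda>w i. C i w) -` A \<inter> space M" and ?ND = "(\<lambda>w. \<lambda>t\<in>{0..}. N t w) -` ?D \<inter> space M"
  have "prob {w \<in> space M. (\<lambda>i. C i w) \<in> A \<and> (\<lambda>n. T n w) \<in> D} = prob (?CA \<inter> ?ND)"
  proof (rule finite_measure_eq_AE)
    show "AE w in M. w \<in> {w \<in> space M. (\<lambda>i. C i w) \<in> A \<and> (\<lambda>n. T n w) \<in> D} \<longleftrightarrow> w \<in> ?CA \<inter> ?ND"
      using eq AE_space by eventually_elim (use space_N in auto)
  qed (use D' in measurable)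
  also have "\<dots> = prob ?CA * prob ?ND"
    by (rule prob_indep_elems[OF ind A D'])
  also have "prob ?ND = prob {w \<in> space M. (\<lambda>n. T n w) \<in> D}"
  proof (rule finite_measure_eq_AE)
    show "AE w in M. w \<in> ?ND \<longleftrightarrow> w \<in> {w \<in> space M. (\<lambda>n. T n w) \<in> D}"
      using eq AE_space by eventually_elim (use space_N in auto)
  qed (use D' in measurable)
  also have "?CA = {w \<in> space M. (\<lambda>i. C i w) \<in> A}" by auto
  finally show ?thesis .
qed

text \<open>Merges two mutually independent families into one, so that blocks mixing members of both
  can be formed. A finite index set of the sum type splits into its \<open>Inl\<close> and
  \<open>Inr\<close> parts.\<close>

lemma indep_vars_case_sum:
  fixes X :: "'i \<Rightarrow> 'a \<Rightarrow> 'b" and Y :: "'j \<Rightarrow> 'a \<Rightarrow> 'b"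
  assumes X: "indep_vars (\<lambda>_. N) X UNIV" and Y: "indep_vars (\<lambda>_. N) Y UNIV"
    and XY: "\<And>I J E F. finite I \<Longrightarrow> finite J \<Longrightarrow> (\<And>i. i \<in> I \<Longrightarrow> E i \<in> sets N) \<Longrightarrow> (\<And>j. j \<in> J \<Longrightarrow> F j \<in> sets N) \<Longrightarrow>
      prob {w \<in> space M. (\<forall>i\<in>I. X i w \<in> E i) \<and> (\<forall>j\<in>J. Y j w \<in> F j)}
        = prob {w \<in> space M. \<forall>i\<in>I. X i w \<in> E i} * prob {w \<in> space M. \<forall>j\<in>J. Y j w \<in> F j}"
  shows "indep_vars (\<lambda>_. N) (case_sum X Y) UNIV"
  unfolding indep_vars_def2
proof (intro conjI ballI indep_setsI)
  have rv: "random_variable N (X i)" "random_variable N (Y j)" for i j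
    using X Y by (auto simp: indep_vars_def2)
  then show "random_variable N (case_sum X Y i)" for i by (cases i) auto
  then show "{case_sum X Y i -` A \<inter> space M |A. A \<in> sets N} \<subseteq> events" for i
    by (auto intro: measurable_sets)
  fix A and K :: "('i + 'j) set"
  assume K: "K \<noteq> {}" "finite K" and "\<forall>j\<in>K. A j \<in> {case_sum X Y j -` A \<inter> space M |A. A \<in> sets N}"
  then have "\<forall>j\<in>K. \<exists>B. A j = case_sum X Y j -` B \<inter> space M \<and> B \<in> sets N" by blast
  from bchoice[OF this] obtain B where B: "\<And>j. j \<in> K \<Longrightarrow> A j = case_sum X Y j -` B j \<inter> space M \<and> B j \<in> sets N"
    by blast
  define I where "I = Inl -` K"
  define J where "J = Inr -` K"
  have K_eq: "K = Inl ` I \<union> Inr ` J"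
  proof (rule set_eqI)
    show "x \<in> K \<longleftrightarrow> x \<in> Inl ` I \<union> Inr ` J" for x by (cases x) (auto simp: I_def J_def)
  qed
  have fin: "finite I" "finite J" using K(2) by (auto simp: I_def J_def intro!: finite_vimageI)
  have "(\<Inter>j\<in>K. A j) = {w \<in> space M. (\<forall>i\<in>I. X i w \<in> B (Inl i)) \<and> (\<forall>j\<in>J. Y j w \<in> B (Inr j))}"
  proof -
    have "(\<Inter>j\<in>K. A j) = (\<Inter>j\<in>K. case_sum X Y j -` B j \<inter> space M)" using B by auto
    also have "\<dots> = {w \<in> space M. \<forall>j\<in>K. case_sum X Y j w \<in> B j}" using K(1) by auto
    finally show ?thesis by (simp add: K_eq ball_Un)
  qed
  then have "prob (\<Inter>j\<in>K. A j)
    = prob {w \<in> space M. \<forall>i\<in>I. X i w \<in> B (Inl i)} * prob {w \<in> space M. \<forall>j\<in>J. Y j w \<in> B (Inr j)}"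
    using B fin by (simp add: XY K_eq)
  also have "\<dots> = (\<Prod>i\<in>I. prob (X i -` B (Inl i) \<inter> space M)) * (\<Prod>j\<in>J. prob (Y j -` B (Inr j) \<inter> space M))"
    using B fin by (simp add: indep_vars_prob_Ball[OF X] indep_vars_prob_Ball[OF Y] K_eq)
  also have "\<dots> = (\<Prod>j\<in>K. prob (case_sum X Y j -` B j \<inter> space M))"
    unfolding K_eq using fin
    by (subst prod.union_disjoint) (auto simp: prod.reindex)
  also have "\<dots> = (\<Prod>j\<in>K. prob (A j))" using B by (intro prod.cong) auto
  finally show "prob (\<Inter>j\<in>K. A j) = (\<Prod>j\<in>K. prob (A j))" .
qed

text \<open>Claims and scaled gaps form one independent family, and the disjoint blocks {Inl i, Inr
  i} yield independent differences. Scaling a gap by \<open>r\<close> divides its exponential rate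
  by \<open>r\<close>.\<close>

lemma distr_walk:
  fixes C :: "nat \<Rightarrow> 'a \<Rightarrow> real"
  assumes T: "poisson_epochs M rate T" and rate: "0 < rate" and r: "0 < r"
    and N: "\<And>t w. 0 \<le> t \<Longrightarrow> w \<in> space M \<Longrightarrow> N t w = card {n. 1 \<le> n \<and> T n w \<le> t}"
    and C: "indep_vars (\<lambda>_. borel) C UNIV" and distr_C: "\<And>i. distr M borel (C i) = \<beta>"
    and ind: "indep_elems M (\<Pi>\<^sub>M i\<in>UNIV. borel) (\<lambda>w i. C i w)
      (\<Pi>\<^sub>M t\<in>{0::real..}. count_space UNIV) (\<lambda>w. \<lambda>t\<in>{0..}. N t w)"
  shows "distr M (\<Pi>\<^sub>M i\<in>UNIV. borel) (\<lambda>w i. C i w - r * (T (Suc i) w - T i w))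
    = (\<Pi>\<^sub>M i\<in>UNIV. distr (\<beta> \<Otimes>\<^sub>M density lborel (exponential_density (rate / r))) borel (\<lambda>(b, s). b - s))"
proof -
  define S where "S i w = r * (T (Suc i) w - T i w)" for i w
  note [measurable] = poisson_epochs_measurable[OF T]
  have C_meas [measurable]: "random_variable borel (C i)" for i using C by (auto simp: indep_vars_def2)
  have S_meas [measurable]: "random_variable borel (S i)" for i unfolding S_def by measurable
  have S: "indep_vars (\<lambda>_. borel) S UNIV"
    unfolding S_def using T by (intro indep_vars_compose2[where Y = "\<lambda>_ x. r * x"]) (auto simp: poisson_epochs_def)
  let ?Z = "case_sum C S"
  have Z: "indep_vars (\<lambda>_. borel) ?Z UNIV"
  proof (rule indep_vars_case_sum[OF C S])
    fix I J :: "nat set" and E F :: "nat \<Rightarrow> real set"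
    assume fin: "finite I" "finite J" and E: "\<And>i. i \<in> I \<Longrightarrow> E i \<in> sets borel" and F: "\<And>j. j \<in> J \<Longrightarrow> F j \<in> sets borel"
    let ?P = "(\<Pi>\<^sub>M i\<in>UNIV. borel) :: (nat \<Rightarrow> real) measure"
    have [simp]: "space ?P = UNIV" by (simp add: space_PiM)
    have A: "{x \<in> space ?P. \<forall>i\<in>I. x i \<in> E i} \<in> sets ?P"
    proof (intro sets.sets_Collect_finite_All fin)
      fix i assume "i \<in> I"
      then have "(\<lambda>x. x i) -` E i \<inter> space ?P \<in> sets ?P"
        by (intro measurable_sets[OF _ E]) measurable
      then show "{x \<in> space ?P. x i \<in> E i} \<in> sets ?P" by (simp add: vimage_def)
    qed
    \<comment> \<open>The event about gaps is phrased as a set of epoch sequences, because the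
      independence at hand concerns the epochs.\<close>
    have D: "{x \<in> space ?P. \<forall>j\<in>J. r * (x (Suc j) - x j) \<in> F j} \<in> sets ?P"
    proof (intro sets.sets_Collect_finite_All fin)
      fix j assume "j \<in> J"
      then have "(\<lambda>x. r * (x (Suc j) - x j)) -` F j \<inter> space ?P \<in> sets ?P"
        by (intro measurable_sets[OF _ F]) measurable
      then show "{x \<in> space ?P. r * (x (Suc j) - x j) \<in> F j} \<in> sets ?P" by (simp add: vimage_def)
    qed
    show "prob {w \<in> space M. (\<forall>i\<in>I. C i w \<in> E i) \<and> (\<forall>j\<in>J. S j w \<in> F j)}
        = prob {w \<in> space M. \<forall>i\<in>I. C i w \<in> E i} * prob {w \<in> space M. \<forall>j\<in>J. S j w \<in> F j}"
      using prob_claims_epochs[OF T rate N ind A D] by (simp add: S_def)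
  qed
  let ?X = "\<lambda>i w. C i w - S i w"
  have "indep_vars (\<lambda>i. \<Pi>\<^sub>M j\<in>{Inl i, Inr i}. borel) (\<lambda>i w. \<lambda>j\<in>{Inl i, Inr i}. ?Z j w) UNIV"
    by (rule indep_vars_restrict[OF Z]) (auto simp: disjoint_family_on_def)
  then have "indep_vars (\<lambda>_. borel) (\<lambda>i w. (\<lambda>x. x (Inl i) - x (Inr i)) (\<lambda>j\<in>{Inl i, Inr i}. ?Z j w)) UNIV"
    by (rule indep_vars_compose2) measurable
  then have X: "indep_vars (\<lambda>_. borel) ?X UNIV" by simp
  have distr_S: "distr M borel (S i) = density lborel (exponential_density (rate / r))" for i
  proof -
    have "distributed M lborel (S i) (exponential_density (rate / r))"
      unfolding S_def using T rate r by (intro exponential_distributed_scale[OF prob_space_axioms]) (auto simp: poisson_epochs_def)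
    then have "distr M lborel (S i) = density lborel (exponential_density (rate / r))" by (simp add: distributed_def)
    moreover have "distr M lborel (S i) = distr M borel (S i)" by (intro distr_cong) auto
    ultimately show ?thesis by simp
  qed
  have distr_X: "distr M borel (?X i) = distr (\<beta> \<Otimes>\<^sub>M density lborel (exponential_density (rate / r))) borel (\<lambda>(b, s). b - s)" for i
  proof -
    \<comment> \<open>The one-term sum lets \<open>indep_vars_sum\<close> deliver the independence
      of a pair.\<close>
    have "indep_var borel (?Z (Inl i)) borel (\<lambda>w. \<Sum>j\<in>{Inr i}. ?Z j w)"
      by (rule indep_vars_sum) (auto intro: indep_vars_subset[OF Z])
    then have "indep_var borel (C i) borel (S i)" by simp
    then have "distr M borel (C i) \<Otimes>\<^sub>M distr M borel (S i) = distr M (borel \<Otimes>\<^sub>M borel) (\<lambda>w. (C i w, S i w))"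
      unfolding indep_var_distribution_eq by blast
    then have "distr (\<beta> \<Otimes>\<^sub>M density lborel (exponential_density (rate / r))) borel (\<lambda>(b, s). b - s)
      = distr (distr M (borel \<Otimes>\<^sub>M borel) (\<lambda>w. (C i w, S i w))) borel (\<lambda>(b, s). b - s)"
      by (simp add: distr_C distr_S)
    also have "\<dots> = distr M borel (?X i)" by (subst distr_distr) (auto simp: comp_def)
    finally show ?thesis by simp
  qed
  have "distr M (\<Pi>\<^sub>M i\<in>UNIV. borel) (\<lambda>w. \<lambda>i\<in>UNIV. ?X i w) = (\<Pi>\<^sub>M i\<in>UNIV. distr M borel (?X i))"
    using X by (subst (asm) indep_vars_iff_distr_eq_PiM) auto
  then show ?thesis unfolding distr_X restrict_UNIV unfolding S_def .
qed

end

subsection \<open>Inspection\<close>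

context prob_space
begin

text \<open>Once the surplus process exceeds \<open>u + r L\<close> at a rational time, it stays above \<open>u\<close> for \<open>L\<close> time
  units; the first such time in an enumeration is independent of the inspection epochs.  Rational
  times are used instead of arrival epochs because claims of size zero leave no trace in \<open>Y\<close>, so that
  the arrival epochs need not be independent of the inspection epochs.\<close>

lemma inspection_lower_bound:
  fixes Y :: "real \<Rightarrow> 'a \<Rightarrow> real"
  assumes I: "poisson_epochs M om I" and om: "0 < om" and r: "0 < r" and L: "0 \<le> L"
    and ind: "indep_elems M (\<Pi>\<^sub>M n\<in>UNIV. borel) (\<lambda>w n. I n w)
      (\<Pi>\<^sub>M t\<in>{0::real..}. borel) (\<lambda>w. \<lambda>t\<in>{0..}. Y t w)"
    and decrease: "AE w in M. \<forall>s t. 0 \<le> s \<longrightarrow> s \<le> t \<longrightarrow> Y s w - r * (t - s) \<le> Y t w"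
    and meas: "{w \<in> space M. \<exists>n. u < Y (I n w) w} \<in> events"
  shows "ennreal (1 - exp (- om * L)) * emeasure M {w \<in> space M. \<exists>t\<in>\<rat>. 0 \<le> t \<and> u + r * L < Y t w}
    \<le> emeasure M {w \<in> space M. \<exists>n. u < Y (I n w) w}"
proof -
  let ?PY = "(\<Pi>\<^sub>M t\<in>{0..}. borel) :: (real \<Rightarrow> real) measure"
  let ?PI = "(\<Pi>\<^sub>M n\<in>UNIV. borel) :: (nat \<Rightarrow> real) measure"
  let ?Y = "\<lambda>w. \<lambda>t\<in>{0..}. Y t w" and ?I = "\<lambda>w n. I n w"
  note [measurable] = poisson_epochs_measurable[OF I]
  have Y_meas [measurable]: "?Y \<in> measurable M ?PY" and I_meas [measurable]: "?I \<in> measurable M ?PI"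
    using ind by (auto simp: indep_elems_def)
  have space_PI [simp]: "space ?PI = UNIV" by (simp add: space_PiM)
  define R :: "real set" where "R = \<rat> \<inter> {0..}"
  define t where "t = from_nat_into R"
  have "0 \<in> R" by (simp add: R_def)
  then have range_t: "range t = R"
    unfolding t_def by (intro range_from_nat_into) (auto simp: R_def countable_rat)
  have t0: "0 \<le> t j" for j using range_t by (auto simp: R_def)
  define E where "E j = {y \<in> space ?PY. u + r * L < y (t j)}" for j
  have E: "E j \<in> sets ?PY" for j
  proof -
    have [measurable]: "(\<lambda>y. y (t j)) \<in> borel_measurable ?PY"
      using t0 by (intro measurable_component_singleton) auto
    show ?thesis unfolding E_def by measurable
  qed
  \<comment> \<open>\<open>disjointed E j\<close> says that \<open>t j\<close> is the first time in
    the enumeration, not in the order of time, at which the threshold is exceeded. It concerns the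
    path of Y alone, while \<open>H j\<close> concerns the inspections alone, and \<open>t j\<close>
    itself is deterministic; hence the product formula.\<close>
  have D: "disjointed E j \<in> sets ?PY" for j
    using E sets.range_disjointed_sets[of E ?PY] by auto
  define H where "H j = {x \<in> space ?PI. \<exists>n. x n \<in> {t j..t j + L}}" for j
  have H: "H j \<in> sets ?PI" for j unfolding H_def by measurable
  let ?F = "\<lambda>j. ?Y -` disjointed E j \<inter> space M" and ?G = "\<lambda>j. ?I -` H j \<inter> space M"
  have F: "?F j \<in> events" and G: "?G j \<in> events" for j
    using D H by (auto intro: measurable_sets)
  have disj: "disjoint_family ?F"
    using disjoint_family_disjointed[of E] by (auto simp: disjoint_family_on_def)
  have "{w \<in> space M. \<exists>t\<in>\<rat>. 0 \<le> t \<and> u + r * L < Y t w} = (\<Union>j. ?F j)"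
  proof -
    have "(\<Union>j. ?F j) = ?Y -` (\<Union>j. E j) \<inter> space M"
      unfolding UN_disjointed_eq[of E, symmetric] by auto
    also have "\<dots> = {w \<in> space M. \<exists>j. u + r * L < Y (t j) w}"
      using measurable_space[OF Y_meas] t0 by (auto simp: E_def)
    also have "\<dots> = {w \<in> space M. \<exists>t\<in>range t. u + r * L < Y t w}" by auto
    finally show ?thesis unfolding range_t R_def by auto
  qed
  then have "emeasure M {w \<in> space M. \<exists>t\<in>\<rat>. 0 \<le> t \<and> u + r * L < Y t w} = (\<Sum>j. emeasure M (?F j))"
    by (simp only:) (rule suminf_emeasure[symmetric], use F disj in auto)
  then have "ennreal (1 - exp (- om * L)) * emeasure M {w \<in> space M. \<exists>t\<in>\<rat>. 0 \<le> t \<and> u + r * L < Y t w}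
    = (\<Sum>j. ennreal (1 - exp (- om * L)) * emeasure M (?F j))" by simp
  also have "\<dots> \<le> (\<Sum>j. emeasure M (?G j \<inter> ?F j))"
  proof (intro suminf_le allI)
    fix j
    have "?G j = {w \<in> space M. \<not> (\<forall>n. I n w \<notin> {t j..t j + L})}" by (auto simp: H_def)
    then have "prob (?G j) = 1 - prob {w \<in> space M. \<forall>n. I n w \<notin> {t j..t j + L}}"
      by (simp only:) (rule prob_neg, measurable)
    moreover have "prob {w \<in> space M. \<forall>n. I n w \<notin> {t j..t j + L}} \<le> exp (- om * L)"
      using prob_no_epoch_le[OF I om L t0, of j] by (simp add: emeasure_eq_measure ennreal_le_iff)
    ultimately have "(1 - exp (- om * L)) * prob (?F j) \<le> prob (?G j) * prob (?F j)"
      by (intro mult_right_mono) auto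
    also have "\<dots> = prob (?G j \<inter> ?F j)" by (rule prob_indep_elems[OF ind H D, symmetric])
    finally show "ennreal (1 - exp (- om * L)) * emeasure M (?F j) \<le> emeasure M (?G j \<inter> ?F j)"
      using om L by (simp add: emeasure_eq_measure ennreal_leI flip: ennreal_mult)
  qed auto
  also have "\<dots> = emeasure M (\<Union>j. ?G j \<inter> ?F j)"
  proof (rule suminf_emeasure)
    show "range (\<lambda>j. ?G j \<inter> ?F j) \<subseteq> events" using sets.Int[OF G F] by blast
    show "disjoint_family (\<lambda>j. ?G j \<inter> ?F j)" by (rule disjoint_family_subset[OF disj]) blast
  qed
  also have "\<dots> \<le> emeasure M {w \<in> space M. \<exists>n. u < Y (I n w) w}"
  proof (rule emeasure_mono_AE[OF _ meas])
    show "AE w in M. w \<in> (\<Union>j. ?G j \<inter> ?F j) \<longrightarrow> w \<in> {w \<in> space M. \<exists>n. u < Y (I n w) w}"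
      using decrease
    proof eventually_elim
      case (elim w)
      show ?case
      proof
        assume "w \<in> (\<Union>j. ?G j \<inter> ?F j)"
        then obtain j where w: "w \<in> space M" "?I w \<in> H j" "?Y w \<in> disjointed E j"
          by (elim UN_E IntE vimageE) simp
        have "?Y w \<in> E j" by (rule subsetD[OF disjointed_subset w(3)])
        then have "u + r * L < Y (t j) w" using t0 by (simp add: E_def)
        moreover obtain n where n: "t j \<le> I n w" "I n w \<le> t j + L" using w(2) by (auto simp: H_def)
        moreover have "Y (t j) w - r * (I n w - t j) \<le> Y (I n w) w"
          using elim n(1) t0[of j] by simp
        moreover have "r * (I n w - t j) \<le> r * L" using n r by simp
        ultimately have "u < Y (I n w) w" by linarith
        then show "w \<in> {w \<in> space M. \<exists>n. u < Y (I n w) w}" using w(1) by blast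
      qed
    qed
  qed
  finally show ?thesis .
qed

text \<open>Used for the bankruptcy event. Measurability of each Y(t) says nothing about Y at a
  random time, so the number of claims is written as an explicit count of the epochs up to S and
  composed with the countably many partial sums. The sign of S matters because N is specified only
  for t \<ge> 0.\<close>

lemma random_sum_at_random_time_measurable:
  fixes C T :: "nat \<Rightarrow> 'a \<Rightarrow> real"
  assumes T: "\<And>n. T n \<in> borel_measurable M" and S: "S \<in> borel_measurable M" "\<And>w. w \<in> space M \<Longrightarrow> 0 \<le> S w"
    and C: "\<And>i. C i \<in> borel_measurable M"
    and N: "\<And>t w. 0 \<le> t \<Longrightarrow> w \<in> space M \<Longrightarrow> N t w = card {n. 1 \<le> n \<and> T n w \<le> t}"
  shows "(\<lambda>w. net_claims N C r (S w) w) \<in> borel_measurable M"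
proof -
  note [measurable] = T S(1) C
  have "(\<lambda>w. card {n. 1 \<le> n \<and> T n w \<le> S w}) \<in> measurable M (count_space UNIV)"
    by measurable
  then have [measurable]: "(\<lambda>w. N (S w) w) \<in> measurable M (count_space UNIV)"
    by (rule measurable_cong[THEN iffD1, rotated]) (simp add: N S(2))
  have [measurable]: "(\<lambda>w. \<Sum>i<N (S w) w. C i w) \<in> borel_measurable M"
    by (rule measurable_compose_countable[where f = "\<lambda>k w. \<Sum>i<k. C i w" and g = "\<lambda>w. N (S w) w"]) measurable
  show ?thesis unfolding net_claims_def by measurable
qed

lemma bankruptcy_prob_eq:
  "bankruptcy_prob M Y I u = prob {w \<in> space M. \<exists>n. u < Y (I n w) w}"
  unfolding bankruptcy_prob_def by (simp add: less_SUP_iff)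

end

text \<open>The layer-cake formula by Fubini. Negative b contribute nothing on either side, since
  \<open>ennreal b\<close> is 0 there.\<close>

lemma nn_integral_eq_tail:
  assumes "sigma_finite_measure \<beta>" and [measurable_cong]: "sets \<beta> = sets borel"
  shows "(\<integral>\<^sup>+b. ennreal b \<partial>\<beta>) = (\<integral>\<^sup>+y. pos_tail \<beta> y \<partial>lborel)"
proof -
  interpret sigma_finite_measure \<beta> by fact
  interpret pair_sigma_finite lborel \<beta> ..
  have [simp]: "space \<beta> = UNIV" using sets_eq_imp_space_eq[OF assms(2)] by simp
  have "(\<integral>\<^sup>+b. ennreal b \<partial>\<beta>) = (\<integral>\<^sup>+b. \<integral>\<^sup>+y. indicator {0..} y * indicator {0<..} (b - y) \<partial>lborel \<partial>\<beta>)"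
  proof (intro nn_integral_cong)
    fix b :: real
    have "(\<integral>\<^sup>+y. indicator {0..} y * indicator {0<..} (b - y) \<partial>lborel) = (\<integral>\<^sup>+y. indicator {0..<b} y \<partial>lborel)"
      by (intro nn_integral_cong) (auto simp: indicator_def)
    also have "\<dots> = emeasure lborel {0..<b}" by simp
    also have "\<dots> = ennreal b" by (cases "0 \<le> b") (auto simp: ennreal_neg)
    finally show "ennreal b = (\<integral>\<^sup>+y. indicator {0..} y * indicator {0<..} (b - y) \<partial>lborel)" by simp
  qed
  also have "\<dots> = (\<integral>\<^sup>+y. \<integral>\<^sup>+b. indicator {0..} y * indicator {0<..} (b - y) \<partial>\<beta> \<partial>lborel)"
    by (rule Fubini') measurable
  also have "\<dots> = (\<integral>\<^sup>+y. pos_tail \<beta> y \<partial>lborel)"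
  proof (intro nn_integral_cong)
    fix y :: real
    have "(\<integral>\<^sup>+b. indicator {0..} y * indicator {0<..} (b - y) \<partial>\<beta>) = (\<integral>\<^sup>+b. indicator {0..} y * indicator {y<..} b \<partial>\<beta>)"
      by (intro nn_integral_cong) (auto simp: indicator_def)
    also have "\<dots> = pos_tail \<beta> y"
      by (simp add: nn_integral_cmult pos_tail_def mult.commute)
    finally show "(\<integral>\<^sup>+b. indicator {0..} y * indicator {0<..} (b - y) \<partial>\<beta>) = pos_tail \<beta> y" .
  qed
  finally show ?thesis .
qed

subsection \<open>Asymptotics of the bankruptcy probability\<close>

lemma (in prob_space) tail_measurable:
  assumes [measurable]: "B \<in> borel_measurable M"
  shows "tail M B \<in> borel_measurable borel"
proof -
  have "mono (\<lambda>y. - tail M B y)"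
    unfolding tail_def by (intro monoI) (auto intro!: finite_measure_mono)
  from borel_measurable_mono[OF this] show ?thesis by simp
qed

lemma (in prob_space) emeasure_distr_greaterThan:
  assumes "B \<in> borel_measurable M"
  shows "emeasure (distr M borel B) {x<..} = ennreal (tail M B x)"
  using assms by (subst emeasure_distr)
    (auto simp: tail_def emeasure_eq_measure intro!: arg_cong[where f = "measure M"])

text \<open>The class is defined through the integral of the tail over the half-line; the layer-cake
  formula and B \<ge> 0 identify this constant with E B. The rest translates Lebesgue integrals of
  reals into nonnegative ones.\<close>

lemma S_star_integrated_tail:
  assumes "prob_space M" and B [measurable]: "B \<in> borel_measurable M" and B0: "AE w in M. B w \<ge> 0" and int: "integrable M B"
    and S: "S_star M B" and a: "0 < a" and am: "a * (\<integral>w. B w \<partial>M) < 1"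
  shows "integrated_tail (distr M borel B) a (\<integral>w. B w \<partial>M)"
proof -
  interpret M: prob_space M by fact
  let ?\<beta> = "distr M borel B"
  interpret \<beta>: prob_space ?\<beta> by (rule M.prob_space_distr) measurable
  define m where "m = (\<integral>w. B w \<partial>M)"
  note tail_eq = M.emeasure_distr_greaterThan[OF B]
  have tail_pos: "0 < tail M B x" for x using S by (simp add: S_star_def)
  note [measurable] = M.tail_measurable[OF B]
  have pos_tail: "pos_tail ?\<beta> y = ennreal (tail M B y) * indicator {0..} y" for y
    by (simp add: pos_tail_def tail_eq)
  then have "pos_tail ?\<beta> = (\<lambda>y. ennreal (tail M B y) * indicator {0..} y)" by (rule ext)
  then have [measurable]: "pos_tail ?\<beta> \<in> borel_measurable borel" by simp
  have mean: "(\<integral>\<^sup>+y. pos_tail ?\<beta> y \<partial>lborel) = ennreal m"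
  proof -
    have "(\<integral>\<^sup>+y. pos_tail ?\<beta> y \<partial>lborel) = (\<integral>\<^sup>+b. ennreal b \<partial>?\<beta>)"
      by (rule nn_integral_eq_tail[symmetric]) (auto intro: \<beta>.sigma_finite_measure_axioms)
    also have "\<dots> = (\<integral>\<^sup>+w. ennreal (B w) \<partial>M)" by (simp add: nn_integral_distr)
    also have "\<dots> = ennreal m" unfolding m_def by (rule nn_integral_eq_integral[OF int B0])
    finally show ?thesis .
  qed
  have m0: "0 \<le> m" unfolding m_def using B0 by (rule integral_nonneg_AE)
  have m_eq: "(LBINT y:{0..}. tail M B y) = m"
  proof -
    have "(LBINT y:{0..}. tail M B y) = enn2real (\<integral>\<^sup>+y. ennreal (indicator {0..} y *\<^sub>R tail M B y) \<partial>lborel)"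
      unfolding set_lebesgue_integral_def using tail_pos
      by (intro integral_eq_nn_integral) (auto simp: less_imp_le)
    also have "(\<integral>\<^sup>+y. ennreal (indicator {0..} y *\<^sub>R tail M B y) \<partial>lborel) = (\<integral>\<^sup>+y. pos_tail ?\<beta> y \<partial>lborel)"
      by (intro nn_integral_cong) (auto simp: pos_tail indicator_def)
    finally show ?thesis using mean m0 by simp
  qed
  define D where "D x = (LBINT y:{0..x}. tail M B (x - y) * tail M B y)" for x
  have conv: "(\<integral>\<^sup>+y. pos_tail ?\<beta> (x - y) * pos_tail ?\<beta> y \<partial>lborel) = ennreal (D x)" for x
  proof -
    let ?J = "\<integral>\<^sup>+y. pos_tail ?\<beta> (x - y) * pos_tail ?\<beta> y \<partial>lborel"
    have "D x = enn2real (\<integral>\<^sup>+y. ennreal (indicator {0..x} y *\<^sub>R (tail M B (x - y) * tail M B y)) \<partial>lborel)"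
      unfolding D_def set_lebesgue_integral_def using tail_pos
      by (intro integral_eq_nn_integral) (auto simp: less_imp_le)
    also have "(\<integral>\<^sup>+y. ennreal (indicator {0..x} y *\<^sub>R (tail M B (x - y) * tail M B y)) \<partial>lborel) = ?J"
      using tail_pos by (intro nn_integral_cong) (auto simp: pos_tail indicator_def ennreal_mult less_imp_le)
    finally have D: "D x = enn2real ?J" .
    \<comment> \<open>Finiteness is essential here: \<open>enn2real\<close> would send an infinite
      value to 0.\<close>
    have "?J \<le> (\<integral>\<^sup>+y. pos_tail ?\<beta> y \<partial>lborel)"
    proof (intro nn_integral_mono)
      fix y
      have "pos_tail ?\<beta> (x - y) \<le> 1"
        by (auto simp: pos_tail_def indicator_def intro: \<beta>.measure_le_1)
      then show "pos_tail ?\<beta> (x - y) * pos_tail ?\<beta> y \<le> pos_tail ?\<beta> y"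
        using mult_right_mono[of "pos_tail ?\<beta> (x - y)" 1 "pos_tail ?\<beta> y"] by simp
    qed
    then have "?J < \<top>" using mean by (auto intro: le_less_trans)
    then show ?thesis using D by simp
  qed
  have asymp: "D \<sim>[at_top] (\<lambda>x. 2 * m * tail M B x)"
    using S unfolding S_star_def D_def m_eq by simp
  have tail_nle: "\<not> tail M B x \<le> 0" for x using tail_pos[of x] by simp
  have mpos: "0 < m"
  proof (rule ccontr)
    assume "\<not> 0 < m"
    then have "(\<integral>\<^sup>+y. pos_tail ?\<beta> y \<partial>lborel) = 0" using mean by (simp add: ennreal_neg not_less)
    then have "AE y in lborel. pos_tail ?\<beta> y = 0"
      by (subst (asm) nn_integral_0_iff_AE) (auto simp: pos_tail)
    then have "AE y in lborel. y \<notin> {0..1::real}"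
      by eventually_elim (auto simp: pos_tail ennreal_eq_0_iff tail_nle indicator_def split: if_splits)
    then have "emeasure lborel {0..1::real} = 0"
      by (subst (asm) AE_iff_measurable[of "{0..1}"]) auto
    then show False by simp
  qed
  show ?thesis
    unfolding m_def[symmetric]
  proof (unfold_locales)
    show "sets ?\<beta> = sets borel" by simp
    have "emeasure ?\<beta> {..<0} = emeasure M {w \<in> space M. B w < 0}"
      by (subst emeasure_distr) (auto intro!: arg_cong[where f = "emeasure M"])
    also have "\<dots> = 0"
      using B0 by (subst (asm) AE_iff_measurable[of "{w \<in> space M. B w < 0}"]) (auto simp: not_le)
    finally show "emeasure ?\<beta> {..<0} = 0" .
    show "emeasure ?\<beta> {x<..} \<noteq> 0" for x using tail_pos[of x] by (simp add: tail_eq ennreal_eq_0_iff not_le)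
    show "0 < a" by (rule a)
    show "(\<integral>\<^sup>+y. pos_tail ?\<beta> y \<partial>lborel) = ennreal m" by (rule mean)
    show "a * m < 1" using am by (simp add: m_def)
    fix e :: real assume e: "0 < e"
    \<comment> \<open>Asymptotic equivalence reads 0/0 as 1. Positive denominators reduce it to
      ordinary convergence of the quotient.\<close>
    have "((\<lambda>x. D x / (2 * m * tail M B x)) \<longlongrightarrow> 1) at_top"
    proof (rule Lim_transform_eventually)
      show "((\<lambda>x. if D x = 0 \<and> 2 * m * tail M B x = 0 then 1 else D x / (2 * m * tail M B x)) \<longlongrightarrow> 1) at_top"
        using asymp_equivD[OF asymp] by simp
      show "\<forall>\<^sub>F x in at_top. (if D x = 0 \<and> 2 * m * tail M B x = 0 then 1 else D x / (2 * m * tail M B x))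
          = D x / (2 * m * tail M B x)"
        using mpos tail_pos by (auto simp: less_le)
    qed
    \<comment> \<open>The tolerance is e / (2 m), since (1 + e / (2 m)) 2 m = 2 m + e.\<close>
    then have "\<forall>\<^sub>F x in at_top. D x / (2 * m * tail M B x) < 1 + e / (2 * m)"
      using e mpos by (intro order_tendstoD) auto
    then show "\<forall>\<^sub>F x in at_top. (\<integral>\<^sup>+y. pos_tail ?\<beta> (x - y) * pos_tail ?\<beta> y \<partial>lborel) \<le> ennreal (2 * m + e) * pos_tail ?\<beta> x"
      using eventually_ge_at_top[of 0]
    proof eventually_elim
      case (elim x)
      have "D x \<le> (1 + e / (2 * m)) * (2 * m * tail M B x)"
        using elim(1) mpos tail_pos[of x] by (subst (asm) pos_divide_less_eq) auto
      also have "\<dots> = (2 * m + e) * tail M B x" using mpos by (simp add: field_simps)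
      finally have "ennreal (D x) \<le> ennreal (2 * m + e) * ennreal (tail M B x)"
        using mpos e tail_pos[of x] ennreal_leI by (subst ennreal_mult[symmetric]) auto
      then show ?case
        unfolding conv using elim(2) by (simp only: pos_tail indicator_simps atLeast_iff mult_1_right)
    qed
  qed
qed

lemma tail_residual_lifetime:
  assumes "prob_space M" and B [measurable]: "B \<in> borel_measurable M"
    and it: "integrated_tail (distr M borel B) a (\<integral>w. B w \<partial>M)"
    and R: "residual_lifetime M B R" and x: "0 \<le> x"
  shows "tail M R x = integrated_tail.q (distr M borel B) x / (\<integral>w. B w \<partial>M)"
proof -
  interpret M: prob_space M by fact
  let ?\<beta> = "distr M borel B"
  define m where "m = (\<integral>w. B w \<partial>M)"
  interpret integrated_tail ?\<beta> a m using it by (simp add: m_def)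
  have [measurable]: "R \<in> borel_measurable M" using R by (simp add: residual_lifetime_def)
  note tail_eq = M.emeasure_distr_greaterThan[OF B]
  note [measurable] = M.tail_measurable[OF B]
  have "(LBINT y:{0..x}. tail M B y / m) = (LBINT y:{0..x}. tail M B y) / m"
    by (simp add: set_integral_divide_zero)
  also have "(LBINT y:{0..x}. tail M B y) = enn2real (\<integral>\<^sup>+y. ennreal (indicator {0..x} y *\<^sub>R tail M B y) \<partial>lborel)"
    unfolding set_lebesgue_integral_def
    by (intro integral_eq_nn_integral) (auto simp: tail_def)
  also have "(\<integral>\<^sup>+y. ennreal (indicator {0..x} y *\<^sub>R tail M B y) \<partial>lborel) = (\<integral>\<^sup>+y. f y * indicator {..x} y \<partial>lborel)"
    by (intro nn_integral_cong) (auto simp: pos_tail_def tail_eq indicator_def)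
  also have "enn2real \<dots> = m - q x"
    using q_le_mean[of x] by (simp add: mean_split_real)
  finally have "(LBINT y:{0..x}. tail M B y / m) = (m - q x) / m" .
  then have "M.prob {w \<in> space M. R w \<le> x} = (m - q x) / m"
    using R x by (simp add: residual_lifetime_def m_def)
  moreover have "M.prob {w \<in> space M. x < R w} = 1 - M.prob {w \<in> space M. R w \<le> x}"
    by (subst M.prob_neg[symmetric]) (auto simp: not_le)
  ultimately show ?thesis
    using m_pos by (simp add: tail_def m_def[symmetric] diff_divide_distrib)
qed

text \<open>For the lower half, fix L so large that (1 - exp(- om L)) c still exceeds the prescribed
  x < c. For this fixed L the shift by r L does not affect \<open>q\<close> asymptotically, so
  \<psi>(u + r L) / q(u) also tends to c.\<close>

lemma asymp_equiv_sandwich_shift: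
  fixes p \<psi> q :: "real \<Rightarrow> real"
  assumes upper: "\<And>u. 0 \<le> u \<Longrightarrow> p u \<le> \<psi> u"
    and lower: "\<And>u L. 0 \<le> u \<Longrightarrow> 0 \<le> L \<Longrightarrow> (1 - exp (- om * L)) * \<psi> (u + r * L) \<le> p u"
    and \<psi>: "((\<lambda>u. \<psi> u / q u) \<longlongrightarrow> c) at_top" and q: "\<And>u. 0 < q u"
    and shift: "\<And>A. 0 \<le> A \<Longrightarrow> ((\<lambda>u. q (u - A) / q u) \<longlongrightarrow> 1) at_top"
    and om: "0 < om" and r: "0 < r"
  shows "((\<lambda>u. p u / q u) \<longlongrightarrow> c) at_top"
proof (rule order_tendstoI)
  fix x assume "c < x"
  then have "\<forall>\<^sub>F u in at_top. \<psi> u / q u < x" using \<psi> by (intro order_tendstoD) auto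
  then show "\<forall>\<^sub>F u in at_top. p u / q u < x"
    using eventually_ge_at_top[of 0]
  proof eventually_elim
    case (elim u)
    have "p u / q u \<le> \<psi> u / q u" using upper[OF elim(2)] q[of u] by (simp add: divide_right_mono)
    then show ?case using elim(1) by simp
  qed
next
  fix x assume x: "x < c"
  have "((\<lambda>L. (1 - exp (- om * L)) * c) \<longlongrightarrow> (1 - 0) * c) at_top"
    using om by (intro tendsto_intros filterlim_compose[OF exp_at_bot] filterlim_tendsto_neg_mult_at_bot[OF tendsto_const])
      (auto intro: filterlim_ident)
  then have "\<forall>\<^sub>F L in at_top. x < (1 - exp (- om * L)) * c" using x by (intro order_tendstoD) auto
  then have "\<forall>\<^sub>F L in at_top. 0 \<le> L \<and> x < (1 - exp (- om * L)) * c"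
    using eventually_ge_at_top[of 0] by eventually_elim auto
  then obtain L where L: "0 \<le> L" "x < (1 - exp (- om * L)) * c"
    using eventually_happens[of _ "at_top :: real filter"] by auto
  let ?A = "r * L"
  have lim: "filterlim (\<lambda>u. u + ?A) at_top at_top"
    using r L by (intro filterlim_at_top_mono[OF filterlim_ident]) auto
  have "((\<lambda>u. \<psi> (u + ?A) / q (u + ?A)) \<longlongrightarrow> c) at_top"
    by (rule filterlim_compose[OF \<psi> lim])
  moreover have "((\<lambda>u. inverse (q (u + ?A - ?A) / q (u + ?A))) \<longlongrightarrow> inverse 1) at_top"
    using r L by (intro tendsto_inverse filterlim_compose[OF shift lim]) auto
  ultimately have "((\<lambda>u. (1 - exp (- om * L)) * (\<psi> (u + ?A) / q (u + ?A) * inverse (q (u + ?A - ?A) / q (u + ?A))))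
      \<longlongrightarrow> (1 - exp (- om * L)) * (c * inverse 1)) at_top"
    by (intro tendsto_mult tendsto_const)
  moreover have "\<psi> (u + ?A) / q (u + ?A) * inverse (q (u + ?A - ?A) / q (u + ?A)) = \<psi> (u + ?A) / q u" for u
    using q[of "u + ?A"] q[of u] by (simp add: field_simps)
  ultimately have "((\<lambda>u. (1 - exp (- om * L)) * (\<psi> (u + ?A) / q u)) \<longlongrightarrow> (1 - exp (- om * L)) * c) at_top"
    by (simp only: inverse_1 mult_1_right)
  then have "\<forall>\<^sub>F u in at_top. x < (1 - exp (- om * L)) * (\<psi> (u + ?A) / q u)"
    using L(2) by (rule order_tendstoD)
  then show "\<forall>\<^sub>F u in at_top. x < p u / q u"
    using eventually_ge_at_top[of 0]
  proof eventually_elim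
    case (elim u)
    have "(1 - exp (- om * L)) * (\<psi> (u + ?A) / q u) \<le> p u / q u"
      using lower[OF elim(2) L(1)] q[of u] by (simp add: divide_right_mono)
    then show ?case using elim(1) by simp
  qed
qed

theorem proposition4:
  fixes M :: "'a measure"
    and lam r om :: real
    and N :: "real \<Rightarrow> 'a \<Rightarrow> nat"
    and B B_res :: "'a \<Rightarrow> real"
    and C I :: "nat \<Rightarrow> 'a \<Rightarrow> real"
  defines "Y \<equiv> net_claims N C r"
  assumes "prob_space M"
    and "lam > 0" and "r > 0" and "om > 0"
    and "B \<in> borel_measurable M" and "AE w in M. B w \<ge> 0" and "integrable M B"
    and "poisson_process M lam N"
    and "prob_space.indep_vars M (\<lambda>_. borel) C UNIV"
    and "\<And>i. distr M borel (C i) = distr M borel B"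
    and "indep_elems M
           (\<Pi>\<^sub>M i\<in>UNIV. borel) (\<lambda>w. \<lambda>i. C i w)
           (\<Pi>\<^sub>M t\<in>{0::real..}. count_space UNIV) (\<lambda>w. \<lambda>t\<in>{0..}. N t w)"
    and "poisson_epochs M om I"
    and "indep_elems M
           (\<Pi>\<^sub>M n\<in>UNIV. borel) (\<lambda>w. \<lambda>n. I n w)
           (\<Pi>\<^sub>M t\<in>{0::real..}. borel) (\<lambda>w. \<lambda>t\<in>{0..}. Y t w)"
    and "lam * (\<integral>w. B w \<partial>M) < r"
    and "S_star M B"
    and "residual_lifetime M B B_res"
  shows "bankruptcy_prob M Y I
           \<sim>[at_top] (\<lambda>u. lam * (\<integral>w. B w \<partial>M) / (r - lam * (\<integral>w. B w \<partial>M)) * tail M B_res u)"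
proof -
  interpret M: prob_space M by fact
  let ?\<beta> = "distr M borel B"
  define m where "m = (\<integral>w. B w \<partial>M)"
  define a where "a = lam / r"
  have a: "0 < a" using assms by (simp add: a_def)
  have am: "a * m < 1" using assms by (simp add: a_def m_def)
  have it: "integrated_tail ?\<beta> a (\<integral>w. B w \<partial>M)"
    using assms(2,6,7,8,16) a am unfolding m_def by (intro S_star_integrated_tail)
  interpret R: integrated_tail ?\<beta> a m using it by (simp add: m_def)
  obtain T where T: "poisson_epochs M lam T"
    and N: "\<And>t w. 0 \<le> t \<Longrightarrow> w \<in> space M \<Longrightarrow> N t w = card {n. 1 \<le> n \<and> T n w \<le> t}"
    using assms(9) unfolding poisson_process_def by blast
  note I = \<open>poisson_epochs M om I\<close>
  note [measurable] = poisson_epochs_measurable[OF T] poisson_epochs_measurable[OF I]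
  have C_meas [measurable]: "C i \<in> borel_measurable M" for i
    using assms(10) by (auto simp: M.indep_vars_def2)
  define X where "X i w = C i w - r * (T (Suc i) w - T i w)" for i w
  have [measurable]: "X i \<in> borel_measurable M" for i unfolding X_def by measurable
  define W where "W u = {w \<in> space M. \<exists>k. u < (\<Sum>i\<le>k. X i w)}" for u
  define V where "V u = {w \<in> space M. \<exists>n. u < Y (I n w) w}" for u

  have W_sets: "W u \<in> sets M" for u unfolding W_def by measurable
  have V_sets: "V u \<in> sets M" for u
  proof -
    have [measurable]: "(\<lambda>w. Y (I n w) w) \<in> borel_measurable M" for n
      unfolding Y_def using poisson_epochs_nonneg[OF I]
      by (intro M.random_sum_at_random_time_measurable[where T = T] N) auto
    show ?thesis unfolding V_def by measurable
  qed

  have "AE w in M. 0 \<le> C i w" for i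
  proof -
    have "AE b in ?\<beta>. 0 \<le> b" using assms(6,7) by (subst AE_distr_iff) auto
    then have "AE b in distr M borel (C i). 0 \<le> b" unfolding assms(11) .
    then show ?thesis by (subst (asm) AE_distr_iff) auto
  qed
  then have "AE w in M. \<forall>i. 0 \<le> C i w" by (simp add: AE_all_countable)
  with M.AE_epochs_unbounded[OF T \<open>lam > 0\<close>] AE_space
  have path: "AE w in M. w \<in> space M \<and> claim_path (\<lambda>n. T n w) (\<lambda>t. N t w) (\<lambda>i. C i w) r
    \<and> (\<forall>t. claim_path.Y (\<lambda>t. N t w) (\<lambda>i. C i w) r t = Y t w)"
  proof eventually_elim
    case (elim w)
    have "claim_path (\<lambda>n. T n w) (\<lambda>t. N t w) (\<lambda>i. C i w) r"
    proof
      show "T 0 w = 0" by (rule poisson_epochs_pathD(1)[OF T elim(2)])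
      show "k \<le> N t w \<longleftrightarrow> T k w \<le> t" if "0 \<le> t" for k t
        unfolding N[OF that elim(2)]
        using poisson_epochs_pathD[OF T elim(2)] elim(1) that by (intro le_card_epochs_iff) auto
    qed (use elim \<open>r > 0\<close> in auto)
    then show ?case using elim(2) by (simp add: claim_path.Y_def Y_def net_claims_def)
  qed

  have ruin: "emeasure M (W u) = R.ruin u" for u
  proof -
    have X_seq: "(\<lambda>w i. X i w) \<in> measurable M (\<Pi>\<^sub>M i\<in>UNIV. borel)"
      by (intro measurable_PiM_single') (auto simp: space_PiM)
    have "R.walk = distr M (\<Pi>\<^sub>M i\<in>UNIV. borel) (\<lambda>w i. X i w)"
      unfolding X_def R.increment_def unfolding a_def
      by (rule M.distr_walk[OF T \<open>lam > 0\<close> \<open>r > 0\<close> N assms(10,11,12), symmetric])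
    then have "R.ruin u = emeasure (distr M (\<Pi>\<^sub>M i\<in>UNIV. borel) (\<lambda>w i. X i w)) {\<omega> \<in> space R.walk. \<exists>k. u < (\<Sum>i\<le>k. \<omega> i)}"
      by (simp add: R.ruin_def)
    also have "\<dots> = emeasure M ((\<lambda>w i. X i w) -` {\<omega> \<in> space R.walk. \<exists>k. u < (\<Sum>i\<le>k. \<omega> i)} \<inter> space M)"
    proof (rule emeasure_distr[OF X_seq])
      have "sets R.walk = sets (\<Pi>\<^sub>M i\<in>UNIV. borel :: real measure)" by (intro sets_PiM_cong) auto
      then show "{\<omega> \<in> space R.walk. \<exists>k. u < (\<Sum>i\<le>k. \<omega> i)} \<in> sets (\<Pi>\<^sub>M i\<in>UNIV. borel)"
        using R.exceed_sets(2)[of u] by simp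
    qed
    also have "\<dots> = emeasure M (W u)"
      by (intro arg_cong[where f = "emeasure M"]) (auto simp: R.space_walk W_def)
    finally show ?thesis by simp
  qed
  define \<psi> where "\<psi> u = enn2real (R.g u)" for u
  have \<psi>: "M.prob (W u) = \<psi> u" if "0 \<le> u" for u
    using ruin[of u] that by (simp add: \<psi>_def measure_def R.ruin_eq_g)

  have upper: "M.prob (V u) \<le> \<psi> u" if u: "0 \<le> u" for u
  proof -
    have "AE w in M. w \<in> V u \<longrightarrow> w \<in> W u"
      using path
    proof eventually_elim
      case (elim w)
      then interpret P: claim_path "\<lambda>n. T n w" "\<lambda>t. N t w" "\<lambda>i. C i w" r by simp
      from elim have w: "w \<in> space M" and Y: "\<And>t. P.Y t = Y t w" by auto
      show ?case
        using P.exceed_imp_walk_exceed[OF poisson_epochs_nonneg[OF I w] u] w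
        unfolding V_def W_def X_def Y by blast
    qed
    then have "M.prob (V u) \<le> M.prob (W u)" by (rule M.finite_measure_mono_AE[OF _ W_sets])
    then show ?thesis using \<psi>[OF u] by simp
  qed

  have lower: "(1 - exp (- om * L)) * \<psi> (u + r * L) \<le> M.prob (V u)" if u: "0 \<le> u" and L: "0 \<le> L" for u L
  proof -
    let ?E = "{w \<in> space M. \<exists>t\<in>\<rat>. 0 \<le> t \<and> u + r * L < Y t w}"
    \<comment> \<open>The independence hypothesis contains the measurability of Y(t) for fixed t
      \<ge> 0; with rational times only, the union below is countable.\<close>
    have Y_path: "(\<lambda>w. \<lambda>t\<in>{0..}. Y t w) \<in> measurable M (\<Pi>\<^sub>M t\<in>{0..}. borel)"
      using assms(14) by (simp add: indep_elems_def)
    have Y_meas: "{w \<in> space M. u + r * L < Y t w} \<in> sets M" if "t \<in> {0..}" for t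
    proof -
      have "(\<lambda>w. (\<lambda>t\<in>{0..}. Y t w) t) \<in> borel_measurable M"
        by (rule measurable_compose[OF Y_path measurable_component_singleton[OF that]])
      then have [measurable]: "Y t \<in> borel_measurable M"
        unfolding restrict_apply'[OF that] .
      show ?thesis by measurable
    qed
    have "?E = (\<Union>t\<in>\<rat> \<inter> {0..}. {w \<in> space M. u + r * L < Y t w})" by auto
    also have "\<dots> \<in> sets M"
      by (rule sets.countable_UN') (use Y_meas in \<open>auto simp: countable_rat\<close>)
    finally have E_sets: "?E \<in> sets M" .
    have "AE w in M. w \<in> W (u + r * L) \<longrightarrow> w \<in> ?E"
      using path
    proof eventually_elim
      case (elim w)
      then interpret P: claim_path "\<lambda>n. T n w" "\<lambda>t. N t w" "\<lambda>i. C i w" r by simp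
      from elim have w: "w \<in> space M" and Y: "\<And>t. P.Y t = Y t w" by auto
      show ?case
        using P.walk_exceed_imp_exceed[OF poisson_epochs_nonneg[OF T w]] w
        unfolding W_def X_def Y by blast
    qed
    then have WE: "emeasure M (W (u + r * L)) \<le> emeasure M ?E"
      by (rule emeasure_mono_AE[OF _ E_sets])
    have "AE w in M. \<forall>s t. 0 \<le> s \<longrightarrow> s \<le> t \<longrightarrow> Y s w - r * (t - s) \<le> Y t w"
      using path
    proof eventually_elim
      case (elim w)
      then interpret P: claim_path "\<lambda>n. T n w" "\<lambda>t. N t w" "\<lambda>i. C i w" r by simp
      from elim have Y: "\<And>t. P.Y t = Y t w" by auto
      show ?case using P.Y_decrease unfolding Y by blast
    qed
    from M.inspection_lower_bound[OF I \<open>om > 0\<close> \<open>r > 0\<close> L assms(14) this V_sets[unfolded V_def]]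
    have "ennreal (1 - exp (- om * L)) * emeasure M ?E \<le> emeasure M (V u)"
      unfolding V_def .
    then have "ennreal (1 - exp (- om * L)) * emeasure M (W (u + r * L)) \<le> emeasure M (V u)"
      using mult_left_mono[OF WE] by (meson order_trans zero_le)
    then have "(1 - exp (- om * L)) * M.prob (W (u + r * L)) \<le> M.prob (V u)"
      using L \<open>om > 0\<close> by (simp add: M.emeasure_eq_measure flip: ennreal_mult)
    then show ?thesis using \<psi>[of "u + r * L"] u L \<open>r > 0\<close> by simp
  qed

  have lim: "((\<lambda>u. M.prob (V u) / R.q u) \<longlongrightarrow> a / (1 - a * m)) at_top"
    by (rule asymp_equiv_sandwich_shift[OF upper lower _ R.q_pos R.q_long_tailed \<open>om > 0\<close> \<open>r > 0\<close>])
       (use R.g_asymp in \<open>simp_all add: \<psi>_def\<close>)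
  define c where "c = a / (1 - a * m)"
  have c: "0 < c" using a am by (simp add: c_def)
  have "((\<lambda>u. M.prob (V u) / R.q u / c) \<longlongrightarrow> c / c) at_top"
    using c lim by (intro tendsto_divide tendsto_const) (auto simp: c_def)
  then have lim1: "((\<lambda>u. M.prob (V u) / R.q u / c) \<longlongrightarrow> 1) at_top"
    using c by simp
  \<comment> \<open>With q(u) = m P(B_res > u) and a = lam / r, the constant is c m = (lam / r) m /
    (1 - lam m / r) = lam m / (r - lam m).\<close>
  have "c * R.q u = lam * m / (r - lam * m) * tail M B_res u" if "0 \<le> u" for u
  proof -
    have "tail M B_res u = R.q u / m"
      using tail_residual_lifetime[OF assms(2,6) it assms(17) that] by (simp add: m_def)
    then show ?thesis using R.m_pos \<open>r > 0\<close> am by (simp add: c_def a_def field_simps)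
  qed
  then have "((\<lambda>u. M.prob (V u) / (lam * m / (r - lam * m) * tail M B_res u)) \<longlongrightarrow> 1) at_top"
    by (intro Lim_transform_eventually[OF lim1] eventually_at_top_linorderI[of 0]) (simp add: mult.commute)
  then show ?thesis
    by (intro asymp_equivI') (simp add: M.bankruptcy_prob_eq V_def m_def)
qed

end
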